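(* Let $b,c\in\mathbb{C}\setminus\{0\}$, $d\in\mathbb{C}$, and $M(z)=\dfrac{b}{cz+d}$. Then for Stirling's method $St_M(z)=z+\dfrac{\big((cz+d)^2-bc\big)^2}{c(cz+d)^3}$: (i) $St_M$ is a rational map of degree $4$ and has $6$ critical points (counted with multiplicity); (ii) $\infty$ is an attracting fixed point of $St_M$ (with multiplier $\tfrac12$); (iii) the number of cycles of Herman rings of $St_M$ is at most $1$; (iv) the Julia set $J(St_M)$ is disconnected.
   Context: For a non-constant rational function $f$, Stirling's iterative root-finding method is the map $St_f(z)=z-\dfrac{f(z)}{f'\big(z-f(z)\big)}$, regarded as a rational self-map of $\widehat{\mathbb{C}}$. The multiplier of a fixed point at $\infty$ of a rational map $F$ is $G'(0)$, where $G(z)=1/F(1/z)$. A Herman ring is a doubly connected periodic Fatou component $U$ of period $p$ on which $F^p$ is conformally conjugate to an irrational rotation of a round annulus. The Julia set is the complement of the Fatou set (the set where the iterates form a normal family locally). *)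

theory Defs
  imports "HOL-Complex_Analysis.Complex_Analysis" "HOL-Computational_Algebra.Polynomial_Factorial"
begin

text \<open>The Riemann sphere is modelled as complex option; None is the point at infinity.\<close>

type_synonym csphere = "complex option"

fun sdist :: "csphere \<Rightarrow> csphere \<Rightarrow> real" where
  "sdist None None = 0"
| "sdist (Some z) None = 2 / sqrt (1 + (cmod z)\<^sup>2)"
| "sdist None (Some z) = 2 / sqrt (1 + (cmod z)\<^sup>2)"
| "sdist (Some z) (Some w) =
     2 * cmod (z - w) / (sqrt (1 + (cmod z)\<^sup>2) * sqrt (1 + (cmod w)\<^sup>2))"

definition sphere_top :: "csphere topology" where
  "sphere_top = topology (\<lambda>S. \<forall>x\<in>S. \<exists>e>0. \<forall>y. sdist x y < e \<longrightarrow> y \<in> S)"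

definition inf_chart :: "complex \<Rightarrow> csphere" where
  "inf_chart u = (if u = 0 then None else Some (1 / u))"

definition inf_coord :: "csphere \<Rightarrow> complex" where
  "inf_coord z = (case z of None \<Rightarrow> 0 | Some w \<Rightarrow> 1 / w)"

definition sph_holomorphic_on :: "(csphere \<Rightarrow> complex) \<Rightarrow> csphere set \<Rightarrow> bool" where
  "sph_holomorphic_on \<phi> U \<longleftrightarrow>
     (\<phi> \<circ> Some) holomorphic_on (Some -` U) \<and> (\<phi> \<circ> inf_chart) holomorphic_on (inf_chart -` U)"

text \<open>The self-map of the sphere induced by the rational function p/q (p, q coprime, q nonzero).\<close>
definition rat_map :: "complex poly \<Rightarrow> complex poly \<Rightarrow> csphere \<Rightarrow> csphere" where
  "rat_map p q z = (case z of
      Some a \<Rightarrow> (if poly q a = 0 then None else Some (poly p a / poly q a))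
    | None \<Rightarrow> (if degree p > degree q then None
               else if degree p = degree q then Some (lead_coeff p / lead_coeff q)
               else Some 0))"

definition rational_map_of :: "(csphere \<Rightarrow> csphere) \<Rightarrow> (complex \<Rightarrow> complex) \<Rightarrow> bool" where
  "rational_map_of F g \<longleftrightarrow> (\<exists>p q. q \<noteq> 0 \<and> coprime p q \<and> F = rat_map p q \<and>
      finite {z. poly q z \<noteq> 0 \<and> g z \<noteq> poly p z / poly q z} \<and> finite {z. poly q z = 0})"

definition stirling_fun :: "(complex \<Rightarrow> complex) \<Rightarrow> complex \<Rightarrow> complex" where
  "stirling_fun f z = z - f z / deriv f (z - f z)"

definition fin_local_deg :: "complex poly \<Rightarrow> complex poly \<Rightarrow> complex \<Rightarrow> nat" where
  "fin_local_deg p q a =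
     (if poly q a \<noteq> 0 then order a (p - smult (poly p a / poly q a) q) else order a q)"

text \<open>x^n p(1/x).\<close>
definition rev_pad :: "nat \<Rightarrow> complex poly \<Rightarrow> complex poly" where
  "rev_pad n p = monom 1 (n - degree p) * reflect_poly p"

text \<open>Local degree of the rational map p/q at a point of the sphere (at infinity via the chart 1/z).\<close>
definition local_deg :: "complex poly \<Rightarrow> complex poly \<Rightarrow> csphere \<Rightarrow> nat" where
  "local_deg p q z = (case z of
      Some a \<Rightarrow> fin_local_deg p q a
    | None \<Rightarrow> (let n = max (degree p) (degree q)
               in fin_local_deg (rev_pad n p) (rev_pad n q) 0))"

text \<open>Critical points are points of local degree at least 2; multiplicity is local degree minus 1.\<close>
definition critical_points :: "complex poly \<Rightarrow> complex poly \<Rightarrow> csphere set" where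
  "critical_points p q = {z. 2 \<le> local_deg p q z}"

definition normal_iter_on :: "(csphere \<Rightarrow> csphere) \<Rightarrow> csphere set \<Rightarrow> bool" where
  "normal_iter_on F U \<longleftrightarrow>
     (\<forall>r::nat \<Rightarrow> nat. \<exists>(s::nat \<Rightarrow> nat) g. strict_mono s \<and>
        (\<forall>K. compactin sphere_top K \<and> K \<subseteq> U \<longrightarrow>
           (\<forall>e>0. \<exists>N. \<forall>k\<ge>N. \<forall>z\<in>K. sdist ((F ^^ r (s k)) z) (g z) < e)))"

definition fatou_set :: "(csphere \<Rightarrow> csphere) \<Rightarrow> csphere set" where
  "fatou_set F = {z. \<exists>U. openin sphere_top U \<and> z \<in> U \<and> normal_iter_on F U}"

definition julia_set :: "(csphere \<Rightarrow> csphere) \<Rightarrow> csphere set" where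
  "julia_set F = UNIV - fatou_set F"

definition fatou_components :: "(csphere \<Rightarrow> csphere) \<Rightarrow> csphere set set" where
  "fatou_components F = connected_components_of (subtopology sphere_top (fatou_set F))"

definition herman_ring :: "(csphere \<Rightarrow> csphere) \<Rightarrow> csphere set \<Rightarrow> bool" where
  "herman_ring F U \<longleftrightarrow> U \<in> fatou_components F \<and>
     (\<exists>p>0. (F ^^ p) ` U = U \<and>
        (\<exists>(\<phi>::csphere \<Rightarrow> complex) (r::real) R (\<theta>::real).
           0 < r \<and> r < R \<and> \<theta> \<notin> \<rat> \<and>
           sph_holomorphic_on \<phi> U \<and>
           bij_betw \<phi> U {w. r < cmod w \<and> cmod w < R} \<and>
           (\<forall>z\<in>U. \<phi> ((F ^^ p) z) = exp (2 * of_real pi * \<i> * of_real \<theta>) * \<phi> z)))"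

definition at_most_one_herman_cycle :: "(csphere \<Rightarrow> csphere) \<Rightarrow> bool" where
  "at_most_one_herman_cycle F \<longleftrightarrow>
     (\<forall>U V. herman_ring F U \<and> herman_ring F V \<longrightarrow> (\<exists>k. (F ^^ k) ` U = V))"

definition attracting_fixed_inf :: "(csphere \<Rightarrow> csphere) \<Rightarrow> complex \<Rightarrow> bool" where
  "attracting_fixed_inf F m \<longleftrightarrow> F None = None \<and>
     ((inf_coord \<circ> F \<circ> inf_chart) has_field_derivative m) (at 0) \<and> cmod m < 1"

end

theory Submission
  imports Defs "HOL-Computational_Algebra.Field_as_Ring"
begin

text \<open>
  An affine change of coordinate turns Stirling's method for every \<open>b / (c z + d)\<close> into the single odd
  rational map \<open>St u = u + (u\<^sup>2 - 1)\<^sup>2 / u\<^sup>3\<close>. On the imaginary axis \<open>St\<close> is \<open>u\<close> times a real factor that is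
  at least \<open>2\<close>, so this axis together with \<open>0\<close> and \<open>\<infinity>\<close> lies in the basin of \<open>\<infinity>\<close>. The parabolic fixed
  points \<open>1\<close> and \<open>-1\<close> lie in the Julia set, because real orbits starting beyond them, arbitrarily close,
  tend to \<open>\<infinity>\<close>. Hence the imaginary axis separates the Julia set.

  There are no Herman rings at all. The core curve \<open>K\<close> of a Herman ring and all its images avoid the
  imaginary axis, since orbits of points of \<open>K\<close> stay bounded. By the maximum principle for \<open>exp (\<plusminus> St\<^sup>n)\<close>
  the iterates of the region \<open>D\<close> enclosed by \<open>K\<close> avoid it too, hence never meet the pole \<open>0\<close>, and are
  bounded by their values on \<open>K\<close>. By Montel's theorem \<open>D\<close> lies in the Fatou set, so in the ring itself;
  but the linearising map has no zeros and constant modulus on \<open>K\<close>, hence constant modulus on \<open>D\<close>, and it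
  cannot be injective.
\<close>

section \<open>Degree and critical points\<close>

text \<open>Coprimality makes \<open>q\<close> and \<open>q'\<close> divide each other, so the two
  reduced fractions differ only by a nonzero constant factor. This removes the freedom in the
  witnesses of \<open>rational_map_of\<close>.\<close>

lemma rat_map_unique:
  assumes cp: "coprime p q" "coprime p' q'" and q: "q \<noteq> 0" "q' \<noteq> 0" and eq: "p * q' = p' * q"
  shows "rat_map p q = rat_map p' q'"
proof -
  have "q dvd p * q'" unfolding eq by (rule dvd_triv_right)
  moreover have "q' dvd p' * q" unfolding eq[symmetric] by (rule dvd_triv_right)
  ultimately have dvd: "q dvd q'" "q' dvd q"
    using cp by (simp_all add: coprime_dvd_mult_right_iff coprime_commute)
  then obtain k where k: "q' = q * k" by (elim dvdE)
  have "degree q' \<le> degree q" using dvd(2) q(1) by (rule dvd_imp_degree_le)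
  moreover have "k \<noteq> 0" using k q(2) by auto
  ultimately have "degree k = 0" using q(1) by (simp add: k degree_mult_eq)
  then obtain \<kappa> where \<kappa>: "k = [:\<kappa>:]" by (rule degree_eq_zeroE)
  have q': "q' = smult \<kappa> q" using k \<kappa> by simp
  have k0: "\<kappa> \<noteq> 0" using \<open>k \<noteq> 0\<close> \<kappa> by auto
  have "smult \<kappa> p * q = p' * q" using eq unfolding q' by simp
  then have p': "p' = smult \<kappa> p" using q(1) mult_right_cancel by metis
  show ?thesis
  proof
    fix z show "rat_map p q z = rat_map p' q' z"
      unfolding p' q' using k0 by (cases z) (simp_all add: rat_map_def)
  qed
qed

text \<open>Infinity is a pole. In the chart 1/z its order is the power of the variable that pads
  the reversed denominator, since \<open>reflect_poly q\<close> has nonzero constant term.\<close>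

lemma local_deg_infinity:
  assumes "degree q < degree p" "q \<noteq> 0"
  shows "local_deg p q None = degree p - degree q"
proof -
  have "order 0 (reflect_poly q) = 0"
    using assms(2) by (intro order_0I) (simp add: poly_0_coeff_0)
  then have "order 0 (rev_pad (degree p) q) = degree p - degree q"
    unfolding rev_pad_def using assms(2) by (subst order_mult) auto
  moreover have "poly (rev_pad (degree p) q) 0 = 0"
    using assms(1) by (simp add: rev_pad_def poly_monom)
  ultimately show ?thesis
    using assms(1) by (simp add: local_deg_def fin_local_deg_def max_def Let_def)
qed

context
  fixes p q :: "complex poly" and a :: complex
  assumes qa: "poly q a \<noteq> 0"
begin

text \<open>Subtracting the value at \<open>a\<close> leaves \<open>P = p - (p(a)/q(a)) q\<close>,
  with a zero at \<open>a\<close> and \<open>P'(a) = W(a)/q(a)\<close> for the Wronskian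
  \<open>W = p' q - p q'\<close>.\<close>

lemma fin_local_deg_noncritical:
  assumes "poly (pderiv p * q - p * pderiv q) a \<noteq> 0"
  shows "fin_local_deg p q a = 1"
proof -
  define P where "P = p - smult (poly p a / poly q a) q"
  have "poly P a = 0" using qa by (simp add: P_def)
  moreover have P': "poly (pderiv P) a \<noteq> 0"
    using assms qa by (simp add: P_def pderiv_diff pderiv_smult field_simps)
  moreover have "P \<noteq> 0" using P' by auto
  ultimately have "order a P = Suc (order a (pderiv P))"
    by (intro order_pderiv) (auto simp: order_root)
  then show ?thesis using P' qa by (simp add: fin_local_deg_def P_def order_0I)
qed

text \<open>One derivative further: \<open>P''(a) = W'(a)/q(a)\<close>, because the terms
  \<open>p' q'\<close> cancel in \<open>W'\<close>. So \<open>P\<close> has a zero of order exactly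
  2.\<close>

lemma fin_local_deg_simple_critical:
  assumes "poly (pderiv p * q - p * pderiv q) a = 0"
    and "poly (pderiv (pderiv p * q - p * pderiv q)) a \<noteq> 0"
  shows "fin_local_deg p q a = 2"
proof -
  define P where "P = p - smult (poly p a / poly q a) q"
  have "poly P a = 0" using qa by (simp add: P_def)
  moreover have "poly (pderiv P) a = 0"
    using assms(1) qa by (simp add: P_def pderiv_diff pderiv_smult field_simps)
  moreover have P'': "poly (pderiv (pderiv P)) a \<noteq> 0"
    using assms(2) qa by (simp add: P_def pderiv_diff pderiv_smult pderiv_mult field_simps)
  moreover have "pderiv P \<noteq> 0" using P'' by auto
  moreover have "P \<noteq> 0" using P'' by auto
  ultimately have "order a P = Suc (order a (pderiv P))"
       "order a (pderiv P) = Suc (order a (pderiv (pderiv P)))"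
    by (blast intro: order_pderiv)+
  then show ?thesis using P'' qa by (simp add: fin_local_deg_def P_def order_0I)
qed

end

section \<open>Stirling's method for \<open>b / (c z + d)\<close> as a reduced fraction\<close>

locale stirling_moebius =
  fixes b c d :: complex
  assumes b: "b \<noteq> 0" and c: "c \<noteq> 0"
begin

abbreviation "w z \<equiv> c * z + d"

text \<open>With \<open>x = c z + d\<close>, hence \<open>c z = x - d\<close>, the numerator over
  the denominator \<open>c x^3\<close> is \<open>2 x^4 - d x^3 - 2 b c x^2 + (b c)^2\<close>.
  Composing with \<open>x\<close> makes degree and coprimality easy to read off.\<close>

definition "num = pcompose [:(b * c)\<^sup>2, 0, - 2 * (b * c), - d, 2:] [:d, c:]"
definition "den = smult c ([:d, c:] ^ 3)"

lemma poly_den: "poly den z = c * w z ^ 3"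
  by (simp add: den_def add.commute mult.commute)

lemma poly_num: "poly num z = z * (c * w z ^ 3) + ((w z)\<^sup>2 - b * c)\<^sup>2"
  by (simp add: num_def poly_pcompose algebra_simps power2_eq_square power3_eq_cube)

lemma degree_den: "degree den = 3"
  using c unfolding den_def by (subst degree_smult_eq, subst degree_power_eq) auto

lemma degree_num: "degree num = 4"
proof -
  have "degree num = degree [:(b * c)\<^sup>2, 0, - 2 * (b * c), - d, 2:] * degree [:d, c:]"
    unfolding num_def by (rule degree_pcompose)
  then show ?thesis using c by simp
qed

lemma den_nz: "den \<noteq> 0"
  using degree_den by auto

text \<open>Modulo the linear factor \<open>[:d, c:]\<close> the numerator reduces to the nonzero
  constant \<open>(b * c)\<^sup>2\<close>.\<close>

lemma coprime_num_den: "coprime num den"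
proof -
  have "coprime num [:d, c:]"
  proof (rule coprimeI)
    fix x assume x: "x dvd num" "x dvd [:d, c:]"
    have "num = [:d, c:] * pcompose [:0, - 2 * (b * c), - d, 2:] [:d, c:] + [:(b * c)\<^sup>2:]"
      by (simp add: num_def pcompose_pCons)
    with x have "x dvd [:(b * c)\<^sup>2:]"
      by (metis dvd_add_right_iff dvd_mult2)
    then show "is_unit x" using b c
      by (metis dvd_trans is_unit_triv mult_eq_0_iff power_not_zero)
  qed
  then have "coprime num ([:c:] * [:d, c:] ^ 3)"
    using c by (metis coprime_mult_right_iff coprime_power_right_iff is_unit_right_imp_coprime is_unit_triv)
  then show ?thesis by (simp add: den_def)
qed

lemma finite_roots_affine: "finite {z. w z = e}"
proof (rule finite_subset)
  show "{z. w z = e} \<subseteq> {(e - d) / c}" using c by (auto simp: field_simps)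
qed simp

lemma quotient_eq: "w z \<noteq> 0 \<Longrightarrow> poly num z / poly den z = z + ((w z)\<^sup>2 - b * c)\<^sup>2 / (c * w z ^ 3)"
  using c by (simp add: poly_num poly_den add_divide_distrib)

text \<open>The second hypothesis keeps the auxiliary point \<open>y = z - M z\<close> off the pole
  of \<open>M\<close>, where the formula for the derivative of \<open>M\<close> fails:
  \<open>w y\<close> has numerator \<open>(w z)\<^sup>2 - b * c\<close>.\<close>

lemma stirling_fun_eq:
  assumes "w z \<noteq> 0" "(w z)\<^sup>2 \<noteq> b * c"
  shows "stirling_fun (\<lambda>z. b / (c * z + d)) z = poly num z / poly den z"
proof -
  define y where "y = z - b / w z"
  have wy: "w y = ((w z)\<^sup>2 - b * c) / w z"
    using assms(1) by (simp add: y_def field_simps power2_eq_square)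
  then have wy0: "w y \<noteq> 0" using assms by simp
  define M where "M = (\<lambda>z. b / (c * z + d))"
  have "(M has_field_derivative - (b * c) / (w y)\<^sup>2) (at y)"
    unfolding M_def using wy0 by (auto intro!: derivative_eq_intros simp: power2_eq_square)
  then have "deriv M y = - (b * c) / (w y)\<^sup>2"
    by (rule DERIV_imp_deriv)
  moreover have "M z = b / w z" "z - M z = y" by (simp_all add: M_def y_def)
  ultimately have "stirling_fun M z = z + (b / w z) * (w y)\<^sup>2 / (b * c)"
    by (simp add: stirling_fun_def)
  also have "\<dots> = z + ((w z)\<^sup>2 - b * c)\<^sup>2 / (c * w z ^ 3)"
  proof -
    have "b / x * (y / x)\<^sup>2 / (b * c) = y\<^sup>2 / (c * x ^ 3)" for x y
      using b c by (cases "x = 0") (simp_all add: field_simps power2_eq_square power3_eq_cube)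
    then show ?thesis unfolding wy by simp
  qed
  finally show ?thesis using quotient_eq assms(1) by (simp add: M_def)
qed

text \<open>Both fractions agree with Stirling's function off a finite set, so the cross difference
  of the fractions has infinitely many roots and vanishes identically.\<close>

lemma rational_map_of_stirling:
  assumes "rational_map_of F (stirling_fun (\<lambda>z. b / (c * z + d)))"
  shows "F = rat_map num den"
proof -
  obtain p q where pq: "q \<noteq> 0" "coprime p q" "F = rat_map p q"
    "finite {z. poly q z \<noteq> 0 \<and> stirling_fun (\<lambda>z. b / (c * z + d)) z \<noteq> poly p z / poly q z}"
    "finite {z. poly q z = 0}"
    using assms unfolding rational_map_of_def by auto
  \<comment> \<open>Collects the points where \<open>p/q\<close> differs from Stirling's function,
    the poles of both fractions, and the points with \<open>(w z)\<^sup>2 = b * c\<close> excluded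
    by \<open>stirling_fun_eq\<close>.\<close>
  define E where "E = {z. poly q z \<noteq> 0 \<and> stirling_fun (\<lambda>z. b / (c * z + d)) z \<noteq> poly p z / poly q z}
    \<union> {z. poly q z = 0} \<union> {z. w z = 0} \<union> {z. w z = csqrt (b * c)} \<union> {z. w z = - csqrt (b * c)}"
  have fin: "finite E" unfolding E_def using pq finite_roots_affine by blast
  have "poly (p * den - num * q) z = 0" if "z \<notin> E" for z
  proof -
    have "w z \<noteq> 0" "(w z)\<^sup>2 \<noteq> b * c"
      using that power2_eq_iff[of "w z" "csqrt (b * c)"] unfolding E_def by auto
    then have "poly p z / poly q z = poly num z / poly den z" "poly den z \<noteq> 0" "poly q z \<noteq> 0"
      using that stirling_fun_eq[of z] c unfolding E_def by (auto simp: poly_den)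
    then show ?thesis by (simp add: field_simps)
  qed
  then have "- E \<subseteq> {z. poly (p * den - num * q) z = 0}" by auto
  moreover have "infinite (- E)" using fin infinite_UNIV_char_0 by (metis Compl_eq_Diff_UNIV finite_Diff2)
  ultimately have "p * den - num * q = 0" using poly_roots_finite finite_subset by blast
  then show ?thesis
    using pq coprime_num_den den_nz by (auto intro!: rat_map_unique)
qed

section \<open>The Wronskian and the six critical points\<close>

lemma poly_wronskian:
  "poly (pderiv num * den - num * pderiv den) z =
    c\<^sup>2 * (w z)\<^sup>2 * (2 * w z ^ 4 + 2 * (b * c) * (w z)\<^sup>2 - 3 * (b * c)\<^sup>2)"
proof -
  have "poly (pderiv num) z = c * (w z * (8 * (w z)\<^sup>2 - 3 * d * w z - 4 * (b * c)))"
    by (simp add: num_def pderiv_pcompose poly_pcompose pderiv_pCons power2_eq_square algebra_simps)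
  moreover have "poly (pderiv den) z = 3 * c\<^sup>2 * (w z)\<^sup>2"
    by (simp add: den_def pderiv_smult pderiv_power pderiv_pCons power2_eq_square algebra_simps)
  moreover have "poly num z = 2 * w z ^ 4 - d * w z ^ 3 - 2 * (b * c) * (w z)\<^sup>2 + (b * c)\<^sup>2"
    by (simp add: num_def poly_pcompose power2_eq_square algebra_simps eval_nat_numeral)
  ultimately show ?thesis
    unfolding poly_diff poly_mult poly_den by algebra
qed

text \<open>Obtained by differentiating the closed form as a function; uniqueness of derivatives
  carries the result over to \<open>pderiv\<close>.\<close>

lemma poly_pderiv_wronskian:
  "poly (pderiv (pderiv num * den - num * pderiv den)) z =
    c ^ 3 * (12 * w z ^ 5 + 8 * (b * c) * w z ^ 3 - 6 * (b * c)\<^sup>2 * w z)"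
proof -
  have "((\<lambda>z. poly (pderiv num * den - num * pderiv den) z) has_field_derivative
     c ^ 3 * (12 * w z ^ 5 + 8 * (b * c) * w z ^ 3 - 6 * (b * c)\<^sup>2 * w z)) (at z)"
    unfolding poly_wronskian by (rule derivative_eq_intros refl | simp)+ algebra
  then show ?thesis using DERIV_unique poly_DERIV by blast
qed

text \<open>The critical points are the pole and the roots of \<open>2 x\<^sup>4 + 2 B x\<^sup>2 - 3 B\<^sup>2\<close> in \<open>x = c z + d\<close>, where
  \<open>B = b c\<close>; \<open>crit_sq 1\<close> and \<open>crit_sq (-1)\<close> are the roots of that quadratic in \<open>x\<^sup>2\<close>.\<close>

definition "crit_sq s = b * c * (complex_of_real ((s * sqrt 7 - 1) / 2))"

lemma crit_sq:
  assumes "s \<in> {1, -1}" shows "2 * (crit_sq s)\<^sup>2 + 2 * (b * c) * crit_sq s - 3 * (b * c)\<^sup>2 = 0"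
proof -
  define t where "t = complex_of_real ((s * sqrt 7 - 1) / 2)"
  have "2 * ((s * sqrt 7 - 1) / 2)\<^sup>2 + 2 * ((s * sqrt 7 - 1) / 2) - 3 = 0"
    using assms by (auto simp: power2_eq_square field_simps)
  then have "complex_of_real (2 * ((s * sqrt 7 - 1) / 2)\<^sup>2 + 2 * ((s * sqrt 7 - 1) / 2) - 3) = 0"
    by (simp only: of_real_0)
  then have "2 * t\<^sup>2 + 2 * t - 3 = 0" unfolding t_def by simp
  moreover have "crit_sq s = b * c * t" by (simp add: crit_sq_def t_def)
  ultimately show ?thesis by algebra
qed

text \<open>\<open>s\<close> selects the root of the quadratic and \<open>t\<close> the sign of its
  square root, so that four sign pairs enumerate the four simple critical points.\<close>

definition "crit_w = (\<lambda>(s, t). t * csqrt (crit_sq s))"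

text \<open>The quartic factors as a quadratic in the square of \<open>x\<close>, whose roots
  \<open>crit_sq 1\<close> and \<open>crit_sq (-1)\<close> have sum \<open>- (b * c)\<close> by
  Vieta.\<close>

lemma crit_w_cases:
  "2 * x ^ 4 + 2 * (b * c) * x\<^sup>2 - 3 * (b * c)\<^sup>2 = 0 \<longleftrightarrow> x \<in> crit_w ` ({1, -1} \<times> {1, -1})"
proof -
  have "2 * x ^ 4 + 2 * (b * c) * x\<^sup>2 - 3 * (b * c)\<^sup>2 = 2 * (x\<^sup>2 - crit_sq 1) * (x\<^sup>2 - crit_sq (-1))"
  proof -
    have "crit_sq 1 + crit_sq (-1) = - (b * c)"
      by (simp add: crit_sq_def field_simps)
    then have "crit_sq (-1) = - (b * c) - crit_sq 1" by (simp add: algebra_simps)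
    with crit_sq[of 1] show ?thesis by simp algebra
  qed
  also have "\<dots> = 0 \<longleftrightarrow> x\<^sup>2 = (csqrt (crit_sq 1))\<^sup>2 \<or> x\<^sup>2 = (csqrt (crit_sq (-1)))\<^sup>2"
    by simp
  also have "\<dots> \<longleftrightarrow> x \<in> crit_w ` ({1, -1} \<times> {1, -1})"
    unfolding power2_eq_iff by (auto simp: crit_w_def)
  finally show ?thesis .
qed

lemma crit_sq_nz: "s \<in> {1, -1} \<Longrightarrow> crit_sq s \<noteq> 0"
  using crit_sq[of s] b c by auto

lemma crit_w_nz: "x \<in> {1, -1} \<times> {1, -1} \<Longrightarrow> crit_w x \<noteq> 0"
  using crit_sq_nz by (auto simp: crit_w_def)

lemma inj_crit_w: "inj_on crit_w ({1, -1} \<times> {1, -1})"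
proof (rule inj_onI, clarify)
  fix s t s' t' assume st: "s \<in> {1, -1}" "t \<in> {1, -1}" "s' \<in> {1, -1}" "t' \<in> {1, -1::complex}"
    and eq: "crit_w (s, t) = crit_w (s', t')"
  have "(crit_w (s, t))\<^sup>2 = crit_sq s" "(crit_w (s', t'))\<^sup>2 = crit_sq s'"
    using st by (auto simp: crit_w_def power_mult_distrib)
  with eq have "crit_sq s = crit_sq s'" by simp
  then have s: "s = s'" using b c by (simp add: crit_sq_def)
  with eq crit_w_nz[of "(s, t)"] st show "s = s' \<and> t = t'"
    by (auto simp: crit_w_def)
qed

text \<open>The pole has order 3 and infinity has local degree 4 - 3 = 1, so the remaining critical
  points are zeros of the quartic factor of the Wronskian. Each is simple, because there
  \<open>2 x^2 + b c\<close> equals \<open>b c\<close> times plus or minus the square root of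
  7.\<close>

lemma critical_points_eq:
  "critical_points num den = (\<lambda>x. Some ((x - d) / c)) ` insert 0 (crit_w ` ({1, -1} \<times> {1, -1}))"
  and local_deg_pole: "local_deg num den (Some ((0 - d) / c)) = 3"
  and local_deg_crit: "x \<in> {1, -1} \<times> {1, -1} \<Longrightarrow> local_deg num den (Some ((crit_w x - d) / c)) = 2"
proof -
  show 3: "local_deg num den (Some ((0 - d) / c)) = 3"
  proof -
    have "den = smult (c ^ 4) ([:- ((0 - d) / c), 1:] ^ 3)"
    proof -
      have "[:d, c:] = smult c [:- ((0 - d) / c), 1:]" using c by simp
      then show ?thesis unfolding den_def smult_power by (simp add: eval_nat_numeral)
    qed
    then have "order ((0 - d) / c) den = 3" using c by (metis order_smult order_power_n_n power_not_zero)
    then show ?thesis using c by (simp add: local_deg_def fin_local_deg_def poly_den)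
  qed
  show 2: "local_deg num den (Some ((crit_w x - d) / c)) = 2" if x: "x \<in> {1, -1} \<times> {1, -1}" for x
  proof -
    define a where "a = (crit_w x - d) / c"
    have wa: "w a = crit_w x" using c by (simp add: a_def)
    have w0: "w a \<noteq> 0" using crit_w_nz[OF x] wa by simp
    have eq: "2 * w a ^ 4 + 2 * (b * c) * (w a)\<^sup>2 - 3 * (b * c)\<^sup>2 = 0"
      using crit_w_cases x wa by auto
    obtain s where s: "s \<in> {1, -1}" "(w a)\<^sup>2 = crit_sq s"
    proof (rule that)
      show "fst x \<in> {1, -1}" using x by auto
      show "(w a)\<^sup>2 = crit_sq (fst x)" using x unfolding wa by (auto simp: crit_w_def power_mult_distrib)
    qed
    have "2 * (w a)\<^sup>2 + b * c = b * c * of_real (s * sqrt 7)"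
      unfolding s(2) by (simp add: crit_sq_def field_simps)
    then have nz: "2 * (w a)\<^sup>2 + b * c \<noteq> 0" using b c s(1) by auto
    \<comment> \<open>The quartic equation eliminates the term in \<open>(b * c)\<^sup>2\<close>,
      leaving factors already known to be nonzero.\<close>
    have "12 * w a ^ 5 + 8 * (b * c) * w a ^ 3 - 6 * (b * c)\<^sup>2 * w a
      = 4 * w a ^ 3 * (2 * (w a)\<^sup>2 + b * c)" using eq by algebra
    then have "poly (pderiv (pderiv num * den - num * pderiv den)) a \<noteq> 0"
      unfolding poly_pderiv_wronskian using nz w0 c by simp
    then have "fin_local_deg num den a = 2"
      using c w0 eq by (intro fin_local_deg_simple_critical; simp only: poly_den poly_wronskian) auto
    then show ?thesis by (simp add: local_deg_def a_def)
  qed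
  show "critical_points num den = (\<lambda>x. Some ((x - d) / c)) ` insert 0 (crit_w ` ({1, -1} \<times> {1, -1}))"
  proof
    show "(\<lambda>x. Some ((x - d) / c)) ` insert 0 (crit_w ` ({1, -1} \<times> {1, -1})) \<subseteq> critical_points num den"
      using 2 3 unfolding critical_points_def by fastforce
    show "critical_points num den \<subseteq> (\<lambda>x. Some ((x - d) / c)) ` insert 0 (crit_w ` ({1, -1} \<times> {1, -1}))"
    proof
      fix z assume z: "z \<in> critical_points num den"
      have "local_deg num den None = 1"
        using local_deg_infinity[of den num] den_nz degree_num degree_den by simp
      with z obtain a where a: "z = Some a"
        by (cases z) (auto simp: critical_points_def)
      have "w a \<in> insert 0 (crit_w ` ({1, -1} \<times> {1, -1}))"
      proof (rule ccontr)
        assume n: "w a \<notin> insert 0 (crit_w ` ({1, -1} \<times> {1, -1}))"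
        then have "w a \<noteq> 0" "2 * w a ^ 4 + 2 * (b * c) * (w a)\<^sup>2 - 3 * (b * c)\<^sup>2 \<noteq> 0"
          using crit_w_cases by auto
        then have "fin_local_deg num den a = 1" using c
          by (intro fin_local_deg_noncritical) (simp_all only: poly_den poly_wronskian, auto)
        then show False using z a by (simp add: critical_points_def local_deg_def)
      qed
      moreover have "z = Some ((w a - d) / c)" using a c by simp
      ultimately show "z \<in> (\<lambda>x. Some ((x - d) / c)) ` insert 0 (crit_w ` ({1, -1} \<times> {1, -1}))"
        by blast
    qed
  qed
qed

lemma finite_critical_points: "finite (critical_points num den)"
  by (simp add: critical_points_eq)

text \<open>The pole contributes 2 and each of the four other points 1.\<close>

lemma sum_critical_points: "(\<Sum>z\<in>critical_points num den. local_deg num den z - 1) = 6"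
proof -
  let ?S = "{1, -1} \<times> {1, -1} :: (real \<times> complex) set"
  have inj: "inj_on (\<lambda>x. Some ((x - d) / c)) A" for A
    using c by (auto simp: inj_on_def)
  have "(\<Sum>z\<in>critical_points num den. local_deg num den z - 1)
    = (\<Sum>x\<in>insert 0 (crit_w ` ?S). local_deg num den (Some ((x - d) / c)) - 1)"
    unfolding critical_points_eq by (subst sum.reindex[OF inj]) simp
  also have "\<dots> = (local_deg num den (Some ((0 - d) / c)) - 1) +
      (\<Sum>x\<in>crit_w ` ?S. local_deg num den (Some ((x - d) / c)) - 1)"
  proof (rule sum.insert)
    show "0 \<notin> crit_w ` ?S"
    proof
      assume "0 \<in> crit_w ` ?S"
      then obtain x where "x \<in> ?S" "0 = crit_w x" by (rule imageE)
      then show False using crit_w_nz[of x] by simp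
    qed
  qed simp
  also have "(\<Sum>x\<in>crit_w ` ?S. local_deg num den (Some ((x - d) / c)) - 1) = (\<Sum>x\<in>?S. 1)"
    unfolding sum.reindex[OF inj_crit_w] by (intro sum.cong refl) (simp only: o_def local_deg_crit)
  also have "(\<Sum>x\<in>?S. 1) = (4 :: nat)"
    by (subst card_eq_sum[symmetric]) (subst card_cartesian_product, simp)
  finally show ?thesis unfolding local_deg_pole by simp
qed

lemma attracting: "attracting_fixed_inf (rat_map num den) (1/2)"
proof -
  \<comment> \<open>\<open>H u\<close> is \<open>u^4 * num(1/u)\<close> with the singularity at 0
    removed. Since \<open>H 0 = 2 * c ^ 4\<close>, the multiplier is
    \<open>c ^ 4 / (2 * c ^ 4)\<close>.\<close>
  define H where "H u = c * (c + d * u) ^ 3 + ((c + d * u)\<^sup>2 - b * c * u\<^sup>2)\<^sup>2" for u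
  have deriv: "((\<lambda>u. u * (c * (c + d * u) ^ 3) / H u) has_field_derivative 1/2) (at 0)"
  proof -
    have H0: "H 0 = 2 * c ^ 4" by (simp add: H_def eval_nat_numeral)
    have "((\<lambda>u. u * (c * (c + d * u) ^ 3)) has_field_derivative c ^ 4) (at 0)"
      by (rule derivative_eq_intros refl | simp)+ (simp add: eval_nat_numeral)
    moreover have "H field_differentiable at 0"
      unfolding H_def by (intro derivative_intros)
    then obtain D where "(H has_field_derivative D) (at 0)"
      by (auto simp: field_differentiable_def)
    ultimately have "((\<lambda>u. u * (c * (c + d * u) ^ 3) / H u) has_field_derivative
        (c ^ 4 * H 0 - 0 * (c * (c + d * 0) ^ 3) * D) / (H 0 * H 0)) (at 0)"
      using c H0 by (intro DERIV_divide) auto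
    then show ?thesis using c unfolding H0 by (simp add: field_simps)
  qed
  \<comment> \<open>The filter \<open>nhds 0\<close> includes the point 0 itself; there both sides
    are 0 because infinity is fixed.\<close>
  have ev: "\<forall>\<^sub>F u in nhds 0. (inf_coord \<circ> rat_map num den \<circ> inf_chart) u = u * (c * (c + d * u) ^ 3) / H u"
  proof -
    have "(H \<longlongrightarrow> H 0) (nhds 0)" unfolding H_def by (intro tendsto_intros filterlim_ident)
    moreover have "H 0 = 2 * c ^ 4" by (simp add: H_def eval_nat_numeral)
    ultimately have "\<forall>\<^sub>F u in nhds 0. H u \<noteq> 0"
      using c by (intro tendsto_imp_eventually_ne[of H "H 0"]) simp_all
    moreover have "\<forall>\<^sub>F u in nhds 0. c + d * u \<noteq> 0"
    proof -
      have "((\<lambda>u. c + d * u) \<longlongrightarrow> c + d * 0) (nhds 0)"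
        by (intro tendsto_intros filterlim_ident)
      then show ?thesis using c by (intro tendsto_imp_eventually_ne) auto
    qed
    ultimately show ?thesis
    proof eventually_elim
      case (elim u)
      show ?case
      proof (cases "u = 0")
        case True
        then show ?thesis using degree_num degree_den by (simp add: inf_chart_def inf_coord_def rat_map_def)
      next
        case False
        have wu: "w (1 / u) = (c + d * u) / u" using False by (simp add: add_divide_distrib)
        then have den0: "poly den (1 / u) \<noteq> 0"
        proof -
          have "w (1 / u) \<noteq> 0" unfolding wu using elim False by (metis divide_eq_0_iff)
          then show ?thesis unfolding poly_den using c by (metis mult_eq_0_iff power_not_zero)
        qed
        have nd: "poly den (1 / u) = c * (c + d * u) ^ 3 / u ^ 3" "poly num (1 / u) = H u / u ^ 4"
        proof -
          have sq: "(x / u)\<^sup>2 - b * c = (x\<^sup>2 - b * c * u\<^sup>2) / u\<^sup>2" for x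
            using False by (simp add: power_divide diff_divide_distrib)
          have "1 / u * (c * (x / u) ^ 3) + ((x / u)\<^sup>2 - b * c)\<^sup>2
              = (c * x ^ 3 + (x\<^sup>2 - b * c * u\<^sup>2)\<^sup>2) / u ^ 4" for x
          proof -
            have "1 / u * (c * (x / u) ^ 3) = c * x ^ 3 / u ^ 4"
              by (simp add: power_divide power4_eq_xxxx power3_eq_cube)
            moreover have "(y / u\<^sup>2)\<^sup>2 = y\<^sup>2 / u ^ 4" for y
              by (simp add: power_divide flip: power_mult)
            ultimately show ?thesis unfolding sq by (simp only: add_divide_distrib)
          qed
          then show "poly num (1 / u) = H u / u ^ 4" unfolding poly_num wu H_def by blast
        qed (unfold poly_den wu, simp add: power_divide)
        have "poly den (1 / u) / poly num (1 / u) = u * (c * (c + d * u) ^ 3) / H u"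
        proof -
          have "x / u ^ 3 / (y / u ^ 4) = u * x / y" for x y
            using False by (simp add: power4_eq_xxxx power3_eq_cube)
          then show ?thesis unfolding nd by blast
        qed
        with den0 show ?thesis using False
          by (simp add: inf_chart_def inf_coord_def rat_map_def)
      qed
    qed
  qed
  have "((inf_coord \<circ> rat_map num den \<circ> inf_chart) has_field_derivative 1/2) (at 0)"
    by (rule DERIV_cong_ev[OF refl ev refl, THEN iffD2, OF deriv])
  then show ?thesis using degree_num degree_den
    by (simp add: attracting_fixed_inf_def rat_map_def norm_divide)
qed

end

section \<open>The Riemann sphere and normal families\<close>

lemma openin_sphere:
  "openin sphere_top S \<longleftrightarrow> (\<forall>x\<in>S. \<exists>e>0. \<forall>y. sdist x y < e \<longrightarrow> y \<in> S)"
proof -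
  have "istopology (\<lambda>S. \<forall>x\<in>S. \<exists>e>0. \<forall>y. sdist x y < e \<longrightarrow> y \<in> S)"
    unfolding istopology_def
  proof (intro conjI allI impI ballI)
    fix S T :: "csphere set" and x
    assume S: "\<forall>x\<in>S. \<exists>e>0. \<forall>y. sdist x y < e \<longrightarrow> y \<in> S"
      and T: "\<forall>x\<in>T. \<exists>e>0. \<forall>y. sdist x y < e \<longrightarrow> y \<in> T" and x: "x \<in> S \<inter> T"
    obtain e where "e > 0" "\<forall>y. sdist x y < e \<longrightarrow> y \<in> S" using S x by auto
    moreover obtain e' where "e' > 0" "\<forall>y. sdist x y < e' \<longrightarrow> y \<in> T" using T x by auto
    ultimately show "\<exists>e>0. \<forall>y. sdist x y < e \<longrightarrow> y \<in> S \<inter> T"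
      by (intro exI[of _ "min e e'"]) auto
  next
    fix \<K> x assume "\<forall>K\<in>\<K>. \<forall>x\<in>K. \<exists>e>0. \<forall>y. sdist x y < e \<longrightarrow> y \<in> K" and "x \<in> \<Union>\<K>"
    then show "\<exists>e>0. \<forall>y. sdist x y < e \<longrightarrow> y \<in> \<Union>\<K>" by (meson UnionE UnionI)
  qed
  then show ?thesis unfolding sphere_top_def by (simp add: topology_inverse')
qed

lemma topspace_sphere [simp]: "topspace sphere_top = UNIV"
proof -
  have "openin sphere_top UNIV" unfolding openin_sphere by (auto intro: exI[of _ 1])
  then show ?thesis using openin_subset by blast
qed

lemma sdist_self [simp]: "sdist x x = 0"
  by (cases x) auto

lemma sdist_le: "sdist (Some z) (Some w) \<le> 2 * cmod (z - w)"
proof -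
  have "1 * 1 \<le> sqrt (1 + (cmod z)\<^sup>2) * sqrt (1 + (cmod w)\<^sup>2)"
    by (intro mult_mono) auto
  then have "2 * cmod (z - w) / (sqrt (1 + (cmod z)\<^sup>2) * sqrt (1 + (cmod w)\<^sup>2)) \<le> 2 * cmod (z - w) / 1"
    by (intro divide_left_mono) auto
  then show ?thesis by simp
qed

lemma sdist_None_less: "0 < M \<Longrightarrow> M \<le> cmod z \<Longrightarrow> sdist (Some z) None < 2 / M"
proof -
  assume M: "0 < M" "M \<le> cmod z"
  have "M < sqrt (1 + (cmod z)\<^sup>2)"
    using M by (intro real_less_rsqrt) (smt (verit) power_mono)
  moreover from this have "0 < sqrt (1 + (cmod z)\<^sup>2) * M" using M by (intro mult_pos_pos) linarith+
  ultimately have "2 / sqrt (1 + (cmod z)\<^sup>2) < 2 / M" by (intro divide_strict_left_mono) simp_all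
  then show ?thesis by simp
qed

lemma sdist_commute: "sdist x y = sdist y x"
  by (cases x; cases y) (simp_all add: norm_minus_commute mult.commute)

text \<open>Gives a gap depending only on \<open>w\<close>, so that an orbit tending to infinity
  cannot have the finite limit \<open>w\<close>.\<close>

lemma sdist_far_finite:
  assumes "cmod z \<ge> 1" "cmod z \<ge> 2 * cmod w"
  shows "sdist (Some z) (Some w) \<ge> 1 / (2 * sqrt (1 + (cmod w)\<^sup>2))"
proof -
  define B where "B = sqrt (1 + (cmod w)\<^sup>2)"
  have B: "B > 0" unfolding B_def by (simp add: add_pos_nonneg)
  have A: "sqrt (1 + (cmod z)\<^sup>2) \<le> 2 * cmod z"
  proof (rule real_le_lsqrt)
    have "1 \<le> (cmod z)\<^sup>2" using assms(1) by (rule one_le_power)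
    then show "1 + (cmod z)\<^sup>2 \<le> (2 * cmod z)\<^sup>2" unfolding power_mult_distrib by simp
  qed simp_all
  have A0: "sqrt (1 + (cmod z)\<^sup>2) > 0" by (simp add: add_pos_nonneg)
  have "cmod z - cmod w \<le> cmod (z - w)" by (rule norm_triangle_ineq2)
  then have "cmod z \<le> 2 * cmod (z - w)" using assms(2) by linarith
  then have "sqrt (1 + (cmod z)\<^sup>2) \<le> 4 * cmod (z - w)" using A by linarith
  then have "1 / 2 \<le> 2 * cmod (z - w) / sqrt (1 + (cmod z)\<^sup>2)"
    using A0 by (simp add: field_simps)
  then have "1 / 2 / B \<le> 2 * cmod (z - w) / sqrt (1 + (cmod z)\<^sup>2) / B"
    using B by (intro divide_right_mono) auto
  then show ?thesis by (simp add: B_def)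
qed

lemma sdist_near_finite:
  assumes "\<delta> > 0"
  obtains e where "e > 0" "\<And>y. sdist (Some z) y < e \<Longrightarrow> \<exists>w. y = Some w \<and> cmod (z - w) < \<delta>"
proof -
  define A C where "A = sqrt (1 + (cmod z)\<^sup>2)" and "C = 1 + cmod z"
  have A: "A > 0" unfolding A_def by (simp add: add_pos_nonneg)
  have C: "C > 0" unfolding C_def by (simp add: add_pos_nonneg)
  \<comment> \<open>\<open>2 / A\<close> is the distance to infinity, which rules out
    \<open>None\<close>. The second bound comes from \<open>sqrt (1 + |w|^2) \<le> C + t\<close>
    with \<open>t = |z - w|\<close>, as \<open>t / (C + t)\<close> increases with
    \<open>t\<close>.\<close>
  define e where "e = min (2 / A) (2 * \<delta> / (A * (C + \<delta>)))"
  show ?thesis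
  proof (rule that)
    show "e > 0" using A C assms by (simp add: e_def)
    fix y assume y: "sdist (Some z) y < e"
    show "\<exists>w. y = Some w \<and> cmod (z - w) < \<delta>"
    proof (cases y)
      case None
      then show ?thesis using y by (simp add: e_def A_def)
    next
      case (Some w)
      define t B where "t = cmod (z - w)" and "B = sqrt (1 + (cmod w)\<^sup>2)"
      have "B \<le> 1 + cmod w"
        unfolding B_def by (intro real_le_lsqrt) (simp_all add: power2_eq_square algebra_simps)
      moreover have "cmod w \<le> cmod z + t" unfolding t_def by (metis norm_minus_commute norm_triangle_sub)
      ultimately have B: "B \<le> C + t" "B > 0" unfolding C_def B_def by (auto simp: add_pos_nonneg)
      have "2 * t / (A * B) < 2 * \<delta> / (A * (C + \<delta>))"
        using y Some by (simp add: e_def A_def B_def t_def)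
      then have "2 * t * (A * (C + \<delta>)) < 2 * \<delta> * (A * B)"
        using A B C assms by (simp add: divide_simps mult.commute)
      then have "A * (t * (C + \<delta>)) < A * (\<delta> * B)" by (simp add: algebra_simps)
      then have "t * (C + \<delta>) < \<delta> * B" using A by (simp only: mult_less_cancel_left_pos)
      also have "\<dots> \<le> \<delta> * (C + t)" using B assms by simp
      finally have "t * C < \<delta> * C" by (simp add: algebra_simps)
      then have "t < \<delta>" using C by simp
      then show ?thesis using Some by (simp add: t_def)
    qed
  qed
qed

text \<open>Identifies the chordal topology with that of the one-point compactification, so that
  openness can be checked in the plane.\<close>

lemma openin_sphere_iff:
  "openin sphere_top S \<longleftrightarrow> open (Some -` S) \<and> (None \<in> S \<longrightarrow> (\<exists>R. \<forall>z. cmod z > R \<longrightarrow> Some z \<in> S))"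
proof
  assume S: "openin sphere_top S"
  have "open (Some -` S)" unfolding open_dist
  proof
    fix z assume "z \<in> Some -` S"
    then obtain e where e: "e > 0" "\<And>y. sdist (Some z) y < e \<Longrightarrow> y \<in> S"
      using S unfolding openin_sphere by auto
    have "y \<in> Some -` S" if "dist y z < e / 2" for y
      using that e(2)[of "Some y"] sdist_le[of z y] by (simp add: dist_norm norm_minus_commute)
    then show "\<exists>e>0. \<forall>y. dist y z < e \<longrightarrow> y \<in> Some -` S" using e(1) by (intro exI[of _ "e / 2"]) auto
  qed
  moreover have "\<exists>R. \<forall>z. cmod z > R \<longrightarrow> Some z \<in> S" if N: "None \<in> S"
  proof -
    obtain e where e: "e > 0" "\<And>y. sdist None y < e \<Longrightarrow> y \<in> S"
      using S N unfolding openin_sphere by meson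
    have "Some z \<in> S" if "cmod z > 2 / e" for z
      using e sdist_None_less[of "2 / e" z] that sdist_commute[of None "Some z"]
      by (intro e(2)) (simp del: sdist.simps)
    then show ?thesis by blast
  qed
  ultimately show "open (Some -` S) \<and> (None \<in> S \<longrightarrow> (\<exists>R. \<forall>z. cmod z > R \<longrightarrow> Some z \<in> S))" by blast
next
  assume S: "open (Some -` S) \<and> (None \<in> S \<longrightarrow> (\<exists>R. \<forall>z. cmod z > R \<longrightarrow> Some z \<in> S))"
  show "openin sphere_top S" unfolding openin_sphere
  proof
    fix x assume x: "x \<in> S"
    show "\<exists>e>0. \<forall>y. sdist x y < e \<longrightarrow> y \<in> S"
    proof (cases x)
      case None
      then obtain R where R: "\<And>z. cmod z > R \<Longrightarrow> Some z \<in> S" using S x by auto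
      \<comment> \<open>The radius is the chordal distance from infinity to the circle of radius
        \<open>max R 0\<close>.\<close>
      have "y \<in> S" if "sdist None y < 2 / sqrt (1 + (max R 0)\<^sup>2)" for y
      proof (cases y)
        case (Some z)
        have "sqrt (1 + (max R 0)\<^sup>2) < sqrt (1 + (cmod z)\<^sup>2)"
          using that Some by (simp add: divide_simps add_pos_nonneg not_less split: if_splits)
        then have "(max R 0)\<^sup>2 < (cmod z)\<^sup>2" by simp
        then have "max R 0 < cmod z" by (rule power2_less_imp_less) simp
        then show ?thesis using R Some by simp
      qed (use x None in simp)
      then show ?thesis using None
        by (intro exI[of _ "2 / sqrt (1 + (max R 0)\<^sup>2)"]) (simp add: add_pos_nonneg)
    next
      case (Some z)
      then obtain \<delta> where \<delta>: "\<delta> > 0" "\<And>w. dist w z < \<delta> \<Longrightarrow> Some w \<in> S"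
        using S x unfolding open_dist by (metis vimageE vimageI)
      obtain e where "e > 0" "\<And>y. sdist (Some z) y < e \<Longrightarrow> \<exists>w. y = Some w \<and> cmod (z - w) < \<delta>"
        using sdist_near_finite[OF \<delta>(1)] by metis
      then show ?thesis using \<delta>(2) Some
        by (metis dist_norm norm_minus_commute)
    qed
  qed
qed

lemma open_Some_image: "open S \<Longrightarrow> openin sphere_top (Some ` S)"
  by (auto simp: openin_sphere_iff inj_vimage_image_eq)

lemma continuous_map_Some: "continuous_map euclidean sphere_top Some"
  by (auto simp: continuous_map openin_sphere_iff vimage_def)

text \<open>Turns the spherical compact sets in the definition of normality into the planar ones of
  Montel's theorem; \<open>the\<close> is a continuous inverse of \<open>Some\<close> on the finite
  points.\<close>

lemma compactin_sphere_vimage: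
  assumes "compactin sphere_top K" "K \<subseteq> Some ` D"
  shows "compact (Some -` K)" "Some -` K \<subseteq> D"
proof -
  have "continuous_map (subtopology sphere_top (range Some)) euclidean (the :: csphere \<Rightarrow> complex)"
    unfolding continuous_map
  proof (intro conjI allI impI)
    fix U :: "complex set" assume "openin euclidean U"
    then have "openin sphere_top (Some ` U)" by (simp add: open_Some_image)
    moreover have "{x \<in> topspace (subtopology sphere_top (range Some)). the x \<in> U} = Some ` U \<inter> range Some"
      by auto
    ultimately show "openin (subtopology sphere_top (range Some))
        {x \<in> topspace (subtopology sphere_top (range Some)). the x \<in> U}"
      by (simp add: openin_subtopology) blast
  qed simp
  moreover have "compactin (subtopology sphere_top (range Some)) K"
    using assms by (auto simp: compactin_subtopology)
  ultimately have "compact (the ` K)" using image_compactin by fastforce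
  moreover have "the ` K = Some -` K" using assms(2) by force
  ultimately show "compact (Some -` K)" by simp
  show "Some -` K \<subseteq> D" using assms(2) by auto
qed

lemma compactin_Some_image: "compact K \<Longrightarrow> compactin sphere_top (Some ` K)"
  using image_compactin[OF _ continuous_map_Some] by simp

lemma connectedin_Some_image: "connected C \<Longrightarrow> connectedin sphere_top (Some ` C)"
  using connectedin_continuous_map_image[OF continuous_map_Some] by simp

section \<open>Fatou components and criteria for normality\<close>

lemma openin_fatou: "openin sphere_top (fatou_set f)"
  by (subst openin_subopen) (auto simp: fatou_set_def)

lemma fatou_component_maximal:
  assumes "U \<in> fatou_components f" "connectedin sphere_top C" "C \<subseteq> fatou_set f" "C \<inter> U \<noteq> {}"
  shows "C \<subseteq> U"
proof -
  have "connectedin (subtopology sphere_top (fatou_set f)) C"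
    using assms by (simp add: connectedin_subtopology)
  moreover have "\<not> disjnt U C" using assms(4) by (auto simp: disjnt_def)
  ultimately show ?thesis
    using assms(1) connected_components_of_maximal unfolding fatou_components_def by blast
qed

lemma fatou_component_subset: "U \<in> fatou_components f \<Longrightarrow> U \<subseteq> fatou_set f"
  unfolding fatou_components_def using connected_components_of_subset by fastforce

text \<open>A small disc around a point of the component lies in the open Fatou set and is
  connected, so it stays in the component.\<close>

lemma open_fatou_component:
  assumes "U \<in> fatou_components f"
  shows "open (Some -` U)"
  unfolding open_contains_ball
proof
  fix z assume z: "z \<in> Some -` U"
  have "open (Some -` fatou_set f)" using openin_fatou openin_sphere_iff by blast
  moreover have "z \<in> Some -` fatou_set f" using z fatou_component_subset[OF assms] by auto
  ultimately obtain e where e: "e > 0" "ball z e \<subseteq> Some -` fatou_set f"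
    unfolding open_contains_ball by blast
  have "Some ` ball z e \<subseteq> U"
  proof (rule fatou_component_maximal[OF assms])
    show "Some ` ball z e \<inter> U \<noteq> {}" using e(1) z by (metis IntI centre_in_ball emptyE imageI vimageD)
  qed (use e(2) in \<open>auto intro: connectedin_Some_image\<close>)
  then show "\<exists>e>0. ball z e \<subseteq> Some -` U" using e(1) by blast
qed

text \<open>Needed because \<open>normal_iter_on\<close> ranges over arbitrary index sequences
  \<open>r\<close>, which may repeat values or fail to increase.\<close>

lemma nat_seq_const_or_tends_infinity:
  fixes r :: "nat \<Rightarrow> nat"
  obtains m s where "strict_mono (s :: nat \<Rightarrow> nat)" "\<And>k. r (s k) = m"
  | "\<And>N. \<exists>K. \<forall>k\<ge>K. r k \<ge> N"
proof (cases "\<exists>m. infinite {k. r k = m}")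
  case True
  then obtain m where m: "infinite {k. r k = m}" by blast
  show ?thesis using that(1)[of "enumerate {k. r k = m}" m] strict_mono_enumerate[OF m]
      enumerate_in_set[OF m] by auto
next
  case False
  have "\<exists>K. \<forall>k\<ge>K. r k \<ge> N" for N
  proof -
    have "{k. r k < N} = (\<Union>m<N. {k. r k = m})" by auto
    then have "finite {k. r k < N}" using False by simp
    then obtain K where "\<forall>k\<in>{k. r k < N}. k < K" by (metis finite_nat_set_iff_bounded)
    then show ?thesis by (metis leI leD mem_Collect_eq)
  qed
  then show ?thesis using that(2) by blast
qed

text \<open>A value \<open>m\<close> taken infinitely often gives a constant subsequence with limit
  \<open>f ^^ m\<close>; otherwise the indices tend to infinity and \<open>g\<close> is the limit of
  the whole sequence.\<close>

lemma normal_iter_on_uniform: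
  assumes "\<And>e. e > 0 \<Longrightarrow> \<exists>N. \<forall>n\<ge>N. \<forall>z\<in>U. sdist ((f ^^ n) z) (g z) < e"
  shows "normal_iter_on f U"
  unfolding normal_iter_on_def
proof
  fix r :: "nat \<Rightarrow> nat"
  show "\<exists>(s :: nat \<Rightarrow> nat) g. strict_mono s \<and> (\<forall>K. compactin sphere_top K \<and> K \<subseteq> U \<longrightarrow>
           (\<forall>e>0. \<exists>N. \<forall>k\<ge>N. \<forall>z\<in>K. sdist ((f ^^ r (s k)) z) (g z) < e))"
  proof (rule nat_seq_const_or_tends_infinity[of r])
    fix m s assume "strict_mono (s :: nat \<Rightarrow> nat)" "\<And>k. r (s k) = m"
    then show ?thesis by (intro exI[of _ s] exI[of _ "f ^^ m"]) simp
  next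
    assume r: "\<And>N. \<exists>K. \<forall>k\<ge>K. r k \<ge> N"
    have "\<exists>N. \<forall>k\<ge>N. \<forall>z\<in>K. sdist ((f ^^ r k) z) (g z) < e" if "K \<subseteq> U" "e > 0" for K e
      using assms[OF that(2)] r that(1) by (meson subsetD)
    then show ?thesis by (intro exI[of _ id] exI[of _ g]) (simp add: strict_mono_id)
  qed
qed

text \<open>Montel's theorem gives locally uniform Euclidean convergence, which
  \<open>sdist_le\<close> transfers to the chordal distance.\<close>

lemma normal_iter_on_Montel:
  assumes D: "open D"
    and holo: "\<And>n. h n holomorphic_on D" and bound: "\<And>n z. z \<in> D \<Longrightarrow> cmod (h n z) \<le> B"
    and iter: "\<And>n z. z \<in> D \<Longrightarrow> (f ^^ n) (Some z) = Some (h n z)"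
  shows "normal_iter_on f (Some ` D)"
  unfolding normal_iter_on_def
proof
  fix r :: "nat \<Rightarrow> nat"
  obtain g s where gs: "strict_mono (s :: nat \<Rightarrow> nat)"
    "\<And>K. compact K \<Longrightarrow> K \<subseteq> D \<Longrightarrow> uniform_limit K ((h \<circ> r) \<circ> s) g sequentially"
  proof (rule Montel[OF D, of "range h" "h \<circ> r"])
    show "\<exists>B. \<forall>h\<in>range h. \<forall>z\<in>K. cmod (h z) \<le> B" if "K \<subseteq> D" for K
      using bound that by blast
  qed (use holo that in auto)
  have "\<exists>N. \<forall>k\<ge>N. \<forall>z\<in>K. sdist ((f ^^ r (s k)) z) (Some (g (the z))) < e"
    if K: "compactin sphere_top K" "K \<subseteq> Some ` D" and e: "e > 0" for K e
  proof -
    have "\<forall>\<^sub>F k in sequentially. \<forall>z\<in>Some -` K. dist (h (r (s k)) z) (g z) < e / 2"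
      using gs(2)[OF compactin_sphere_vimage[OF K]] e unfolding uniform_limit_iff by (auto dest: spec[of _ "e / 2"])
    then obtain N where N: "\<forall>k\<ge>N. \<forall>z\<in>Some -` K. dist (h (r (s k)) z) (g z) < e / 2"
      unfolding eventually_sequentially by blast
    have "sdist ((f ^^ r (s k)) z) (Some (g (the z))) < e" if k: "k \<ge> N" and z: "z \<in> K" for k z
    proof -
      obtain x where x: "z = Some x" "x \<in> D" using K(2) z by auto
      have "dist (h (r (s k)) x) (g x) < e / 2" using N k z x by auto
      then show ?thesis using sdist_le[of "h (r (s k)) x" "g x"] iter[OF x(2)] x(1)
        by (simp add: dist_norm del: sdist.simps)
    qed
    then show ?thesis by blast
  qed
  then show "\<exists>(s :: nat \<Rightarrow> nat) g. strict_mono s \<and> (\<forall>K. compactin sphere_top K \<and> K \<subseteq> Some ` D \<longrightarrow>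
           (\<forall>e>0. \<exists>N. \<forall>k\<ge>N. \<forall>z\<in>K. sdist ((f ^^ r (s k)) z) (g z) < e))"
    using gs(1) by (intro exI[of _ s] exI[of _ "\<lambda>z. Some (g (the z))"]) blast
qed

text \<open>The maximum principle for \<open>exp (- g)\<close>, which only needs \<open>frontier D \<subseteq> K\<close> and no information on
  how \<open>g\<close> maps the region enclosed by \<open>K\<close>.\<close>

lemma Re_pos_if_frontier:
  assumes D: "open D" "bounded D" "frontier D \<subseteq> K" and K: "compact K" "K \<noteq> {}"
    and g: "g holomorphic_on D" "continuous_on (D \<union> K) g"
    and pos: "\<And>z. z \<in> K \<Longrightarrow> Re (g z) > 0" and z: "z \<in> D"
  shows "Re (g z) > 0"
proof -
  have "continuous_on K (\<lambda>z. Re (g z))"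
    using g(2) by (intro continuous_intros) (auto elim: continuous_on_subset)
  then obtain k where k: "k \<in> K" "\<And>z. z \<in> K \<Longrightarrow> Re (g k) \<le> Re (g z)"
    using continuous_attains_inf[OF K] by blast
  have cl: "closure D \<subseteq> D \<union> K" using D(3) closure_Un_frontier[of D] by auto
  have "cmod (exp (- g z)) \<le> exp (- Re (g k))"
  proof (rule maximum_modulus_frontier[OF _ _ D(2) _ z])
    show "(\<lambda>z. exp (- g z)) holomorphic_on interior D"
      using g(1) D(1) by (auto intro!: holomorphic_intros simp: interior_open)
    show "continuous_on (closure D) (\<lambda>z. exp (- g z))"
      using continuous_on_subset[OF g(2) cl] by (intro continuous_intros)
    show "cmod (exp (- g z)) \<le> exp (- Re (g k))" if "z \<in> frontier D" for z
      using k(2)[of z] that D(3) by auto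
  qed
  then show ?thesis using pos[OF k(1)] by simp
qed

text \<open>On the connected set \<open>K\<close> the real part has a constant sign, so the previous
  lemma applies to \<open>g\<close> or to \<open>- g\<close>.\<close>

lemma Re_nonzero_if_frontier:
  assumes D: "open D" "bounded D" "frontier D \<subseteq> K" and K: "compact K" "connected K" "K \<noteq> {}"
    and g: "g holomorphic_on D" "continuous_on (D \<union> K) g"
    and nz: "\<And>z. z \<in> K \<Longrightarrow> Re (g z) \<noteq> 0" and z: "z \<in> D"
  shows "Re (g z) \<noteq> 0"
proof -
  have "continuous_on K (\<lambda>z. Re (g z))"
    using g(2) by (intro continuous_intros) (auto elim: continuous_on_subset)
  then have conn: "connected ((\<lambda>z. Re (g z)) ` K)" using K(2) by (rule connected_continuous_image)
  have "(\<forall>x\<in>K. Re (g x) > 0) \<or> (\<forall>x\<in>K. Re (g x) < 0)"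
  proof (rule ccontr)
    assume "\<not> ?thesis"
    then obtain x y where "x \<in> K" "y \<in> K" "Re (g x) \<le> 0" "0 \<le> Re (g y)" by (auto simp: not_less)
    then have "0 \<in> (\<lambda>z. Re (g z)) ` K"
      using connected_contains_Icc[OF conn, of "Re (g x)" "Re (g y)"] by auto
    then show False using nz by auto
  qed
  then show ?thesis
  proof
    assume "\<forall>x\<in>K. Re (g x) > 0"
    then show ?thesis using Re_pos_if_frontier[OF D K(1,3) g _ z] by auto
  next
    assume *: "\<forall>x\<in>K. Re (g x) < 0"
    have "Re (- g z) > 0"
    proof (rule Re_pos_if_frontier[OF D K(1,3) _ _ _ z])
      show "(\<lambda>z. - g z) holomorphic_on D" using g(1) by (rule holomorphic_on_minus)
      show "continuous_on (D \<union> K) (\<lambda>z. - g z)" using g(2) by (rule continuous_on_minus)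
    qed (use * in auto)
    then show ?thesis by simp
  qed
qed

section \<open>Basin of infinity and parabolic points\<close>

text \<open>In the coordinate \<open>u = (c z + d) / \<beta>\<close> with \<open>\<beta>\<^sup>2 = b c\<close>, Stirling's method for every \<open>b / (c z + d)\<close>
  becomes the following map. Its value at the pole \<open>0\<close> is junk.\<close>

definition St :: "complex \<Rightarrow> complex" where "St u = u + (u\<^sup>2 - 1)\<^sup>2 / u ^ 3"

lemma one_minus_inverse_square: "u \<noteq> 0 \<Longrightarrow> u * (1 - 1 / u\<^sup>2)\<^sup>2 = (u\<^sup>2 - 1)\<^sup>2 / u ^ 3" for u :: "'a :: field"
proof -
  assume u: "u \<noteq> 0"
  then have "1 - 1 / u\<^sup>2 = (u\<^sup>2 - 1) / u\<^sup>2" by (simp add: diff_divide_distrib)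
  then have "u * (1 - 1 / u\<^sup>2)\<^sup>2 = u * ((u\<^sup>2 - 1)\<^sup>2 / (u\<^sup>2)\<^sup>2)" by (simp add: power_divide)
  also have "\<dots> = (u\<^sup>2 - 1)\<^sup>2 / u ^ 3" using u by (simp add: power2_eq_square power3_eq_cube)
  finally show ?thesis .
qed

lemma St_altdef: "u \<noteq> 0 \<Longrightarrow> St u = u * (1 + (1 - 1 / u\<^sup>2)\<^sup>2)"
  by (simp add: St_def distrib_left one_minus_inverse_square)

lemma St_minus: "St (- u) = - St u"
  by (simp add: St_def)

lemma holomorphic_St: "St holomorphic_on (- {0})"
  unfolding St_def by (intro holomorphic_intros) auto

text \<open>With \<open>v = 1 / u\<^sup>2\<close> the factor is \<open>2 - (2 v - v^2)\<close>, and
  \<open>|v| \<le> 1/9\<close> keeps the correction below 1/2.\<close>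

lemma norm_St_near_infinity: "3 \<le> cmod u \<Longrightarrow> 3 / 2 * cmod u \<le> cmod (St u)"
proof -
  assume u: "3 \<le> cmod u"
  define v where "v = 1 / u\<^sup>2"
  have "9 \<le> (cmod u)\<^sup>2" using power_mono[OF u, of 2] by simp
  then have "1 / (cmod u)\<^sup>2 \<le> 1 / 9" by (intro frac_le) auto
  then have v: "cmod v \<le> 1 / 9" by (simp add: v_def norm_divide norm_power)
  then have v2: "cmod (v\<^sup>2) \<le> (1 / 9)\<^sup>2" unfolding norm_power by (intro power_mono) auto
  have *: "1 + (1 - v)\<^sup>2 = 2 - (2 * v - v\<^sup>2)" by algebra
  have "2 - cmod (2 * v - v\<^sup>2) \<le> cmod (2 - (2 * v - v\<^sup>2))"
    using norm_triangle_ineq2[of 2 "2 * v - v\<^sup>2"] by simp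
  moreover have "cmod (2 * v - v\<^sup>2) \<le> 2 * cmod v + cmod (v\<^sup>2)"
    using norm_triangle_ineq4[of "2 * v" "v\<^sup>2"] by (simp add: norm_mult)
  ultimately have "3 / 2 \<le> cmod (1 + (1 - v)\<^sup>2)" using v v2 unfolding * by (simp add: power2_eq_square)
  then have "cmod u * (3 / 2) \<le> cmod u * cmod (1 + (1 - v)\<^sup>2)" by (intro mult_left_mono) auto
  moreover have "St u = u * (1 + (1 - v)\<^sup>2)" unfolding v_def using u by (intro St_altdef) auto
  ultimately show ?thesis by (simp add: norm_mult)
qed

text \<open>Over the denominator \<open>u ^ 3\<close> the numerator is close to 1. The disc is
  chosen to land in one step beyond the radius 3 from which moduli grow.\<close>

lemma norm_St_near_pole: "u \<noteq> 0 \<Longrightarrow> cmod u < 1 / 3 \<Longrightarrow> 3 < cmod (St u)"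
proof -
  assume u0: "u \<noteq> 0" and u: "cmod u < 1 / 3"
  define v where "v = 2 * u\<^sup>2 - 2 * u ^ 4"
  have "u * u ^ 3 + (u\<^sup>2 - 1)\<^sup>2 = 1 - v" unfolding v_def by algebra
  then have St: "St u = (1 - v) / u ^ 3"
    using u0 by (simp add: St_def nonzero_eq_divide_eq distrib_right)
  have "(cmod u)\<^sup>2 \<le> (1 / 3)\<^sup>2" "cmod u ^ 4 \<le> (1 / 3) ^ 4" "cmod u ^ 3 \<le> (1 / 3) ^ 3"
    using u by (intro power_mono; simp)+
  moreover have "cmod v \<le> 2 * (cmod u)\<^sup>2 + 2 * cmod u ^ 4"
    unfolding v_def by (rule order_trans[OF norm_triangle_ineq4]) (simp add: norm_mult norm_power)
  moreover have "1 - cmod v \<le> cmod (1 - v)" using norm_triangle_ineq2[of 1 v] by simp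
  ultimately have "1 / 2 \<le> cmod (1 - v)" "cmod u ^ 3 \<le> 1 / 27"
    by (simp_all add: power_divide)
  then have "3 * cmod u ^ 3 < cmod (1 - v)" by linarith
  then show ?thesis using u0 by (simp add: St norm_divide norm_power field_simps)
qed

text \<open>For \<open>u = i y\<close> one has \<open>1 / u\<^sup>2 = - 1 / y\<^sup>2\<close>, so
  the factor in \<open>St_altdef\<close> is real and at least 2.\<close>

lemma St_imag:
  assumes "u \<noteq> 0" "Re u = 0"
  shows "Re (St u) = 0" "2 * cmod u \<le> cmod (St u)"
proof -
  define y where "y = Im u"
  have u: "u = \<i> * of_real y" using assms(2) by (simp add: y_def complex_eq_iff)
  have y: "y \<noteq> 0" using assms u by auto
  have "u\<^sup>2 = - of_real (y\<^sup>2)"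
    by (simp add: u power_mult_distrib)
  then have St: "St u = u * of_real (1 + (1 + 1 / y\<^sup>2)\<^sup>2)"
    using assms(1) by (subst St_altdef) simp_all
  show "Re (St u) = 0" unfolding St using assms(2) by simp
  have "1 \<le> (1 + 1 / y\<^sup>2)\<^sup>2" by (intro one_le_power) simp
  then have "cmod u * 2 \<le> cmod u * \<bar>1 + (1 + 1 / y\<^sup>2)\<^sup>2\<bar>" by (intro mult_left_mono) auto
  then show "2 * cmod u \<le> cmod (St u)" unfolding St norm_mult norm_of_real by simp
qed

lemma funpow_St_imag:
  assumes "u \<noteq> 0" "Re u = 0"
  shows "Re ((St ^^ n) u) = 0" "2 ^ n * cmod u \<le> cmod ((St ^^ n) u)" "(St ^^ n) u \<noteq> 0"
proof -
  have "Re ((St ^^ n) u) = 0 \<and> 2 ^ n * cmod u \<le> cmod ((St ^^ n) u) \<and> (St ^^ n) u \<noteq> 0"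
  proof (induction n)
    case (Suc n)
    have "0 < 2 ^ Suc n * cmod u" using assms(1) by simp
    also have "\<dots> \<le> 2 * cmod ((St ^^ n) u)" using Suc by simp
    also have "\<dots> \<le> cmod (St ((St ^^ n) u))" using Suc by (intro St_imag) auto
    finally show ?case using St_imag[of "(St ^^ n) u"] Suc by auto
  qed (use assms in simp)
  then show "Re ((St ^^ n) u) = 0" "2 ^ n * cmod u \<le> cmod ((St ^^ n) u)" "(St ^^ n) u \<noteq> 0" by auto
qed

section \<open>Real orbits beyond the parabolic fixed points\<close>

definition St_real :: "real \<Rightarrow> real" where "St_real x = x + (x\<^sup>2 - 1)\<^sup>2 / x ^ 3"

lemma St_of_real: "St (of_real \<sigma> * of_real x) = of_real \<sigma> * of_real (St_real x)" if "\<sigma> \<in> {1, -1}"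
  using that by (auto simp: St_minus) (simp_all add: St_def St_real_def)

lemma funpow_St_of_real: "\<sigma> \<in> {1, -1} \<Longrightarrow> (St ^^ n) (of_real \<sigma> * of_real x) = of_real \<sigma> * of_real ((St_real ^^ n) x)"
  by (induction n) (simp_all only: funpow.simps o_def id_def St_of_real)

text \<open>The increment \<open>x * (1 - 1 / x\<^sup>2)\<^sup>2\<close> increases for
  \<open>x \<ge> 1\<close>, so every step gains at least the increment at the starting point
  \<open>a\<close>. Orbits from \<open>a > 1\<close> therefore escape at least linearly.\<close>

lemma St_real_ge: "1 \<le> a \<Longrightarrow> a \<le> x \<Longrightarrow> x + a * (1 - 1 / a\<^sup>2)\<^sup>2 \<le> St_real x"
proof -
  assume a: "1 \<le> a" "a \<le> x"
  have "St_real x = x + x * (1 - 1 / x\<^sup>2)\<^sup>2"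
    using a by (simp add: St_real_def one_minus_inverse_square)
  moreover have "1 - 1 / a\<^sup>2 \<le> 1 - 1 / x\<^sup>2" using a by (simp add: frac_le power_mono)
  moreover have "0 \<le> 1 - 1 / a\<^sup>2" using a by simp
  ultimately show ?thesis using a by (simp add: mult_mono power_mono)
qed

lemma funpow_St_real_ge: "1 \<le> a \<Longrightarrow> a + n * (a * (1 - 1 / a\<^sup>2)\<^sup>2) \<le> (St_real ^^ n) a"
proof (induction n)
  case (Suc n)
  have "a \<le> a + n * (a * (1 - 1 / a\<^sup>2)\<^sup>2)" using Suc by simp
  then have "(St_real ^^ n) a + a * (1 - 1 / a\<^sup>2)\<^sup>2 \<le> St_real ((St_real ^^ n) a)"
    using Suc by (intro St_real_ge) linarith+
  moreover have "Suc n * (a * (1 - 1 / a\<^sup>2)\<^sup>2) = n * (a * (1 - 1 / a\<^sup>2)\<^sup>2) + a * (1 - 1 / a\<^sup>2)\<^sup>2"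
    by (simp add: distrib_right)
  ultimately show ?case using Suc.IH[OF Suc.prems] unfolding funpow.simps comp_apply by linarith
qed simp

lemma funpow_St_real_1: "(St_real ^^ n) 1 = 1"
  by (induction n) (simp_all add: St_real_def)

lemma isCont_funpow_St_real: "isCont (St_real ^^ n) 1"
proof (induction n)
  case (Suc n)
  have "isCont St_real ((St_real ^^ n) 1)" unfolding funpow_St_real_1 St_real_def by (intro continuous_intros) auto
  then have "isCont (St_real \<circ> (St_real ^^ n)) 1" using Suc by (intro continuous_intros)
  then show ?case by (simp add: o_def)
qed (simp add: id_def)

section \<open>Conjugacy to \<open>St\<close>, escape to infinity, and the Julia set\<close>

context stirling_moebius
begin

definition "\<beta> = csqrt (b * c)"
definition "L z = w z / \<beta>"
definition "A u = (\<beta> * u - d) / c"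

abbreviation "F \<equiv> rat_map num den"

lemma \<beta>_nz: "\<beta> \<noteq> 0" using b c by (simp add: \<beta>_def)

lemma L_A [simp]: "L (A u) = u" using \<beta>_nz c by (simp add: L_def A_def)

lemma A_L [simp]: "A (L z) = z" using \<beta>_nz c by (simp add: L_def A_def)

lemma holomorphic_L: "L holomorphic_on S"
  unfolding L_def using \<beta>_nz by (intro holomorphic_intros) auto

lemma holomorphic_A: "A holomorphic_on S"
  unfolding A_def using c by (intro holomorphic_intros) auto

lemma isCont_L: "isCont L z"
  unfolding L_def using \<beta>_nz by (intro continuous_intros) auto

lemma isCont_A: "isCont A z"
  unfolding A_def using c by (intro continuous_intros) auto

lemma F_None [simp]: "F None = None"
  using degree_num degree_den by (simp add: rat_map_def)

text \<open>The affine map \<open>L\<close> conjugates \<open>F\<close> to \<open>St\<close>, since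
  \<open>\<beta>\<^sup>2 = b * c\<close>. The pole is a separate case because \<open>St 0\<close> is
  only a default value.\<close>

lemma F_Some: "F (Some z) = (if L z = 0 then None else Some (A (St (L z))))"
proof (cases "w z = 0")
  case True
  then show ?thesis using c by (simp add: rat_map_def poly_den L_def)
next
  case False
  have "\<beta>\<^sup>2 = b * c" by (simp add: \<beta>_def)
  then have "(w z)\<^sup>2 - b * c = \<beta>\<^sup>2 * ((L z)\<^sup>2 - 1)"
  proof -
    have "w z = \<beta> * L z" using \<beta>_nz by (simp add: L_def)
    then show ?thesis using \<open>\<beta>\<^sup>2 = b * c\<close> by algebra
  qed
  then have "((w z)\<^sup>2 - b * c)\<^sup>2 / (c * w z ^ 3) = \<beta> * ((L z)\<^sup>2 - 1)\<^sup>2 / (c * L z ^ 3)"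
    using \<beta>_nz False by (simp add: L_def power_mult_distrib power_divide power2_eq_square power3_eq_cube)
  moreover have "A (St (L z)) = z + \<beta> * ((L z)\<^sup>2 - 1)\<^sup>2 / (c * L z ^ 3)"
  proof -
    have "A (St (L z)) = A (L z) + \<beta> * (((L z)\<^sup>2 - 1)\<^sup>2 / L z ^ 3) / c"
      unfolding St_def A_def by (simp only: add_divide_distrib diff_divide_distrib distrib_left) algebra
    then show ?thesis by (simp add: mult.commute)
  qed
  ultimately show ?thesis using False c \<beta>_nz quotient_eq[of z]
    by (simp add: rat_map_def poly_den L_def)
qed

lemma funpow_F_None [simp]: "(F ^^ n) None = None"
  by (induction n) simp_all

lemma funpow_F_Some:
  assumes "\<And>j. j < n \<Longrightarrow> (St ^^ j) (L z) \<noteq> 0"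
  shows "(F ^^ n) (Some z) = Some (A ((St ^^ n) (L z)))"
  using assms by (induction n) (simp_all add: F_Some)

text \<open>Infinity is fixed, so an orbit that is finite at time \<open>n\<close> cannot have met
  the pole earlier. This lets iterates of \<open>F\<close> be traded for those of
  \<open>St\<close>.\<close>

lemma funpow_F_finite:
  assumes "(F ^^ n) (Some z) \<noteq> None" "j < n"
  shows "(St ^^ j) (L z) \<noteq> 0"
  using assms
proof (induction j rule: less_induct)
  case (less j)
  have "(F ^^ n) (Some z) = (F ^^ (n - Suc j)) ((F ^^ Suc j) (Some z))"
    using less.prems(2) by (metis Suc_leI comp_apply funpow_add le_add_diff_inverse2)
  then have "(F ^^ Suc j) (Some z) \<noteq> None" using less.prems(1) by (metis funpow_F_None)
  moreover have "(F ^^ j) (Some z) = Some (A ((St ^^ j) (L z)))"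
    using less by (intro funpow_F_Some) auto
  ultimately show ?case by (auto simp: F_Some)
qed

text \<open>Neighbourhoods of infinity are measured in the coordinate \<open>L\<close>, where the
  growth estimates for \<open>St\<close> hold.\<close>

definition "far M = insert None {Some z |z. M < cmod (L z)}"

lemma F_far:
  assumes "3 \<le> M" "x \<in> far M"
  shows "F x \<in> far (3 / 2 * M)"
proof (cases x)
  case (Some z)
  then have "M < cmod (L z)" using assms(2) by (auto simp: far_def)
  then have "3 / 2 * M < cmod (St (L z))" "L z \<noteq> 0"
    using norm_St_near_infinity[of "L z"] assms(1) by auto
  then show ?thesis using Some by (auto simp: far_def F_Some)
qed (simp add: far_def)

lemma funpow_F_far: "x \<in> far 3 \<Longrightarrow> (F ^^ n) x \<in> far (3 * (3 / 2) ^ n)"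
proof (induction n)
  case (Suc n)
  have "3 \<le> 3 * (3 / 2 :: real) ^ n" by simp
  then show ?case using F_far[OF _ Suc.IH[OF Suc.prems]] by (simp add: mult_ac)
qed simp

lemma sdist_far:
  assumes "e > 0"
  shows "\<exists>M. \<forall>M'\<ge>M. \<forall>x\<in>far M'. sdist x None < e"
proof (intro exI allI impI ballI)
  \<comment> \<open>This threshold for \<open>L z\<close> forces \<open>|z| > 2 / e\<close>, as
    \<open>sdist_None_less\<close> requires.\<close>
  fix M' x assume M': "((2 / e) * cmod c + cmod d) / cmod \<beta> \<le> M'" and x: "x \<in> far M'"
  show "sdist x None < e"
  proof (cases x)
    case (Some z)
    then have "((2 / e) * cmod c + cmod d) / cmod \<beta> < cmod (L z)" using M' x by (auto simp: far_def)
    then have "(2 / e) * cmod c + cmod d < cmod (w z)"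
      using \<beta>_nz by (simp add: L_def norm_divide divide_simps)
    also have "\<dots> \<le> cmod z * cmod c + cmod d" by (metis norm_triangle_ineq norm_mult mult.commute)
    finally have "2 / e * cmod c < cmod z * cmod c" by simp
    then have "2 / e < cmod z" by (rule mult_right_less_imp_less) simp
    then show ?thesis using sdist_None_less[of "2 / e" z] assms Some by simp
  qed (use assms in simp)
qed

text \<open>From the common time \<open>N\<close> on, the radius grows by 3/2 per step, so the
  iterates tend to infinity uniformly on \<open>U\<close>.\<close>

lemma normal_iter_on_escaping:
  assumes U: "\<And>x. x \<in> U \<Longrightarrow> (F ^^ N) x \<in> far 3"
  shows "normal_iter_on F U"
proof (rule normal_iter_on_uniform)
  fix e :: real assume "e > 0"
  then obtain M where M: "\<And>M' x. M \<le> M' \<Longrightarrow> x \<in> far M' \<Longrightarrow> sdist x None < e"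
    using sdist_far by meson
  obtain n0 where n0: "M / 3 < (3 / 2) ^ n0" using real_arch_pow[of "3 / 2" "M / 3"] by auto
  have "sdist ((F ^^ n) x) None < e" if n: "n \<ge> N + n0" and x: "x \<in> U" for n x
  proof (rule M)
    have "(3 / 2 :: real) ^ n0 \<le> (3 / 2) ^ (n - N)" using n by (intro power_increasing) auto
    then show "M \<le> 3 * (3 / 2) ^ (n - N)" using n0 by linarith
    have "(F ^^ n) x = (F ^^ (n - N)) ((F ^^ N) x)"
      using n by (metis add_leD1 comp_apply funpow_add le_add_diff_inverse2)
    then show "(F ^^ n) x \<in> far (3 * (3 / 2) ^ (n - N))" using funpow_F_far[OF U[OF x]] by simp
  qed
  then show "\<exists>N. \<forall>n\<ge>N. \<forall>x\<in>U. sdist ((F ^^ n) x) None < e" by blast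
qed

lemma openin_far: "openin sphere_top (far M)"
  unfolding openin_sphere_iff
proof (intro conjI impI)
  have "Some -` far M = {z. M < cmod (L z)}" by (auto simp: far_def)
  moreover have "continuous_on UNIV (\<lambda>z. cmod (L z))"
    using isCont_L by (intro continuous_intros) (simp add: continuous_at_imp_continuous_on)
  ultimately show "open (Some -` far M)" by (simp add: open_Collect_less)
  have "Some z \<in> far M" if "cmod z > (M * cmod \<beta> + cmod d) / cmod c" for z
  proof -
    have "M * cmod \<beta> + cmod d < cmod z * cmod c" using that c by (simp add: divide_simps)
    also have "\<dots> \<le> cmod (w z) + cmod d"
      using norm_triangle_ineq4[of "w z" d] by (simp add: norm_mult mult.commute)
    finally show ?thesis using \<beta>_nz by (auto simp: far_def L_def norm_divide divide_simps)
  qed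
  then show "\<exists>R. \<forall>z. cmod z > R \<longrightarrow> Some z \<in> far M" by blast
qed

lemma None_in_fatou: "None \<in> fatou_set F"
proof -
  have "normal_iter_on F (far 3)" by (rule normal_iter_on_escaping[of _ 0]) simp
  moreover have "None \<in> far 3" by (simp add: far_def)
  ultimately show ?thesis using openin_far unfolding fatou_set_def by blast
qed

lemma isCont_funpow_St:
  assumes "\<And>j. j < n \<Longrightarrow> (St ^^ j) (L z) \<noteq> 0"
  shows "isCont (\<lambda>z. (St ^^ n) (L z)) z"
  using assms
proof (induction n)
  case (Suc n)
  have "isCont St ((St ^^ n) (L z))"
    using holomorphic_on_imp_continuous_on[OF holomorphic_St] Suc.prems[of n]
    by (simp add: continuous_on_eq_continuous_at open_Compl)
  then show ?case using isCont_o2[OF Suc.IH] Suc.prems by (simp add: less_SucI)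
qed (simp add: isCont_L)

text \<open>A disc around the pole enters \<open>far 3\<close> in one step. Elsewhere on the axis
  moduli double until they exceed 3 at some time \<open>N\<close>, and continuity extends this
  escape to a neighbourhood.\<close>

lemma imag_in_fatou:
  assumes "Re (L z) = 0"
  shows "Some z \<in> fatou_set F"
proof (cases "L z = 0")
  case True
  define U where "U = {z. cmod (L z) < 1 / 3}"
  have "continuous_on UNIV (\<lambda>z. cmod (L z))"
    using isCont_L by (intro continuous_intros) (simp add: continuous_at_imp_continuous_on)
  then have "openin sphere_top (Some ` U)"
    unfolding U_def by (intro open_Some_image open_Collect_less continuous_on_const)
  moreover have "normal_iter_on F (Some ` U)"
  proof (rule normal_iter_on_escaping[of _ 1])
    show "(F ^^ 1) x \<in> far 3" if "x \<in> Some ` U" for x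
    proof -
      obtain y where y: "x = Some y" "cmod (L y) < 1 / 3" using \<open>x \<in> Some ` U\<close> by (auto simp: U_def)
      then show ?thesis using norm_St_near_pole[of "L y"] by (cases "L y = 0") (simp_all add: F_Some far_def)
    qed
  qed
  ultimately show ?thesis using True unfolding fatou_set_def U_def by fastforce
next
  case False
  obtain N where N: "3 / cmod (L z) < 2 ^ N" using real_arch_pow[of 2 "3 / cmod (L z)"] by auto
  then have "3 < 2 ^ N * cmod (L z)" using False by (simp add: field_simps)
  then have N3: "3 < cmod ((St ^^ N) (L z))" using funpow_St_imag(2)[OF False assms, of N] by linarith
  have nz: "(St ^^ j) (L z) \<noteq> 0" for j using funpow_St_imag(3)[OF False assms] by blast
  have lim: "((\<lambda>z. (St ^^ j) (L z)) \<longlongrightarrow> (St ^^ j) (L z)) (nhds z)" for j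
    using isCont_funpow_St[of j z] nz tendsto_at_iff_tendsto_nhds[of "\<lambda>z. (St ^^ j) (L z)" z]
    by (simp add: isCont_def)
  have "\<forall>\<^sub>F x in nhds z. (\<forall>j<N. (St ^^ j) (L x) \<noteq> 0) \<and> 3 < cmod ((St ^^ N) (L x))"
  proof (rule eventually_conj)
    show "\<forall>\<^sub>F x in nhds z. 3 < cmod ((St ^^ N) (L x))"
      using order_tendstoD(1)[OF tendsto_norm[OF lim] N3] by simp
    have "\<forall>\<^sub>F x in nhds z. \<forall>j\<in>{..<N}. (St ^^ j) (L x) \<noteq> 0"
      using tendsto_imp_eventually_ne[OF lim nz] by (intro eventually_ball_finite) auto
    then show "\<forall>\<^sub>F x in nhds z. \<forall>j<N. (St ^^ j) (L x) \<noteq> 0" by (rule eventually_mono) auto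
  qed
  then obtain U where U: "open U" "z \<in> U"
      "\<And>x. x \<in> U \<Longrightarrow> (\<forall>j<N. (St ^^ j) (L x) \<noteq> 0) \<and> 3 < cmod ((St ^^ N) (L x))"
    unfolding eventually_nhds by blast
  have "normal_iter_on F (Some ` U)"
  proof (rule normal_iter_on_escaping[of _ N])
    fix x assume "x \<in> Some ` U"
    then show "(F ^^ N) x \<in> far 3" using U(3) by (auto simp: funpow_F_Some far_def)
  qed
  then show ?thesis using open_Some_image[OF U(1)] U(2) unfolding fatou_set_def by blast
qed

text \<open>Normality would give a subsequence converging uniformly on a short closed arc starting
  at the fixed point. Its limit is infinity at every other point of the arc, so one late iterate is
  near infinity there; continuity at the fixed point then contradicts its being fixed.\<close>

lemma parabolic_in_julia:
  assumes \<sigma>: "\<sigma> \<in> {1, -1}"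
  shows "Some (A (of_real \<sigma>)) \<notin> fatou_set F"
proof
  define P where "P x = A (of_real \<sigma> * of_real x)" for x
  have P1: "P 1 = A (of_real \<sigma>)" by (simp add: P_def)
  assume "Some (A (of_real \<sigma>)) \<in> fatou_set F"
  then obtain U where U: "openin sphere_top U" "Some (P 1) \<in> U" "normal_iter_on F U"
    unfolding fatou_set_def P1 by auto
  have contP: "isCont P x" for x
    unfolding P_def by (rule isCont_o2[OF _ isCont_A]) (intro continuous_intros)
  have FP: "(F ^^ n) (Some (P x)) = Some (P ((St_real ^^ n) x))" if "1 \<le> x" for n x
  proof -
    have nz: "(St ^^ j) (L (P x)) \<noteq> 0" for j
    proof -
      have "x \<le> (St_real ^^ j) x"
        using funpow_St_real_ge[OF that, of j] that by (smt (verit) mult_nonneg_nonneg of_nat_0_le_iff zero_le_power2)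
      then show ?thesis using that \<sigma> by (simp only: P_def L_A funpow_St_of_real) auto
    qed
    then have "(F ^^ n) (Some (P x)) = Some (A ((St ^^ n) (L (P x))))" by (rule funpow_F_Some)
    then show ?thesis by (simp only: P_def L_A funpow_St_of_real[OF \<sigma>])
  qed
  obtain s g where s: "strict_mono (s :: nat \<Rightarrow> nat)" and
    lim': "\<forall>K. compactin sphere_top K \<and> K \<subseteq> U \<longrightarrow>
        (\<forall>e>0. \<exists>N. \<forall>k\<ge>N. \<forall>z\<in>K. sdist ((F ^^ id (s k)) z) (g z) < e)"
    using U(3) unfolding normal_iter_on_def by (metis (no_types))
  have lim: "\<exists>N. \<forall>k\<ge>N. \<forall>z\<in>K. sdist ((F ^^ s k) z) (g z) < e"
    if "compactin sphere_top K" "K \<subseteq> U" "e > 0" for K e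
    using lim' that by simp
  have "open (P -` (Some -` U))"
  proof (rule open_vimage)
    show "open (Some -` U)" using U(1) openin_sphere_iff by blast
    show "continuous_on UNIV P" using contP by (simp add: continuous_at_imp_continuous_on)
  qed
  then obtain \<epsilon> where \<epsilon>: "\<epsilon> > 0" "ball 1 \<epsilon> \<subseteq> P -` (Some -` U)"
    by (rule openE[of _ 1]) (use U(2) in auto)
  define J where "J = {1..1 + \<epsilon> / 2}"
  have JU: "Some ` P ` J \<subseteq> U" using \<epsilon> by (force simp: J_def dist_real_def)
  have cptJ: "compactin sphere_top (Some ` P ` J)"
    using contP unfolding J_def
    by (intro compactin_Some_image compact_continuous_image) (auto simp: continuous_at_imp_continuous_on)
  have g: "g (Some (P x)) = None" if x: "x \<in> J" "x > 1" for x
  proof (rule ccontr)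
    assume "g (Some (P x)) \<noteq> None"
    then obtain y where y: "g (Some (P x)) = Some y" by auto
    define e where "e = 1 / (2 * sqrt (1 + (cmod y)\<^sup>2))"
    have "e > 0" by (simp add: e_def add_pos_nonneg)
    then obtain N where N: "\<forall>k\<ge>N. sdist ((F ^^ s k) (Some (P x))) (Some y) < e"
      using lim[OF cptJ JU] x(1) y by fastforce
    define \<delta> where "\<delta> = x * (1 - 1 / x\<^sup>2)\<^sup>2"
    have "1 / x\<^sup>2 < 1" using x(2) by (simp add: one_less_power)
    then have "0 < 1 - 1 / x\<^sup>2" by linarith
    then have \<delta>: "\<delta> > 0" unfolding \<delta>_def using x(2) by (intro mult_pos_pos zero_less_power) linarith+
    define R where "R = max 1 (2 * cmod y)"
    \<comment> \<open>After \<open>k0\<close> steps the linear escape has carried the orbit far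
      enough for \<open>|P|\<close> to be at least \<open>R\<close>, the radius required by
      \<open>sdist_far_finite\<close>.\<close>
    obtain k0 :: nat where k0: "(R * cmod c + cmod d) / cmod \<beta> < k0 * \<delta>"
      using reals_Archimedean3[OF \<delta>] by blast
    define k where "k = max N k0"
    have "(R * cmod c + cmod d) / cmod \<beta> \<le> (St_real ^^ s k) x"
    proof -
      have "k0 \<le> s k" using seq_suble[OF s, of k] by (simp add: k_def)
      then have "k0 * \<delta> \<le> s k * \<delta>" using \<delta> by simp
      moreover have "x + s k * \<delta> \<le> (St_real ^^ s k) x"
        unfolding \<delta>_def using x(2) by (intro funpow_St_real_ge) simp
      ultimately show ?thesis using k0 x(2) by linarith
    qed
    then have "R * cmod c + cmod d \<le> cmod \<beta> * \<bar>(St_real ^^ s k) x\<bar>"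
      using \<beta>_nz by (simp add: divide_simps mult.commute) (smt (verit) mult_left_mono norm_ge_zero)
    also have "\<dots> = cmod (\<beta> * (of_real \<sigma> * of_real ((St_real ^^ s k) x)))" using \<sigma> by (auto simp: norm_mult)
    also have "\<dots> \<le> cmod (P ((St_real ^^ s k) x)) * cmod c + cmod d"
      using norm_triangle_ineq[of "P ((St_real ^^ s k) x) * c" d] c by (simp add: P_def A_def flip: norm_mult)
    finally have "R \<le> cmod (P ((St_real ^^ s k) x))" using c by simp
    then have "e \<le> sdist (Some (P ((St_real ^^ s k) x))) (Some y)"
      unfolding e_def R_def by (intro sdist_far_finite) auto
    moreover have "sdist ((F ^^ s k) (Some (P x))) (Some y) < e" using N by (simp add: k_def del: sdist.simps)
    ultimately show False using FP[of x "s k"] x(2) by (simp del: sdist.simps)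
  qed
  \<comment> \<open>Half the distance from the fixed point to infinity: a right-hand limit at 1
    bounded by it is impossible.\<close>
  define e where "e = sdist (Some (P 1)) None / 2"
  have "e > 0" by (simp add: e_def add_pos_nonneg)
  then obtain N where N': "\<forall>k\<ge>N. \<forall>z\<in>Some ` P ` J. sdist ((F ^^ s k) z) (g z) < e"
    using lim[OF cptJ JU] by blast
  have N: "sdist (Some (P ((St_real ^^ s N) x))) None < e" if x: "x \<in> J" "x > 1" for x
  proof -
    have "sdist ((F ^^ s N) (Some (P x))) (g (Some (P x))) < e" using N' x(1) by blast
    then show ?thesis unfolding g[OF x] using FP[of x "s N"] x(2) by (simp del: sdist.simps)
  qed
  have "isCont (\<lambda>x. P ((St_real ^^ s N) x)) 1" by (rule isCont_o2[OF isCont_funpow_St_real contP])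
  then have "isCont (\<lambda>x. sdist (Some (P ((St_real ^^ s N) x))) None) 1"
    unfolding sdist.simps by (intro continuous_intros) (simp_all add: add_nonneg_eq_0_iff)
  then have "((\<lambda>x. sdist (Some (P ((St_real ^^ s N) x))) None) \<longlongrightarrow> sdist (Some (P 1)) None) (at_right 1)"
    unfolding isCont_def funpow_St_real_1 by (rule tendsto_within_subset) simp
  moreover have "\<forall>\<^sub>F x in at_right 1. sdist (Some (P ((St_real ^^ s N) x))) None \<le> e"
    unfolding eventually_at_right_field
  proof (intro exI[of _ "1 + \<epsilon> / 2"] conjI allI impI)
    show "sdist (Some (P ((St_real ^^ s N) y))) None \<le> e" if "y > 1" "y < 1 + \<epsilon> / 2" for y
      using N[of y] that by (simp add: J_def del: sdist.simps)
  qed (use \<epsilon>(1) in simp)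
  ultimately have "sdist (Some (P 1)) None \<le> e" by (rule tendsto_upperbound) simp
  then show False using \<open>e > 0\<close> by (simp add: e_def del: sdist.simps)
qed

text \<open>The two open half-planes cut out by the imaginary axis of the coordinate
  \<open>L\<close> cover the Julia set, and each contains one parabolic point.\<close>

lemma julia_disconnected: "\<not> connectedin sphere_top (julia_set F)"
proof -
  define E where "E \<sigma> = Some ` {z. 0 < \<sigma> * Re (L z)}" for \<sigma>
  have E: "Some z \<in> E \<sigma> \<longleftrightarrow> 0 < \<sigma> * Re (L z)" for z \<sigma> by (auto simp: E_def)
  have "openin sphere_top (E \<sigma>)" for \<sigma>
  proof -
    have "continuous_on UNIV (\<lambda>z. \<sigma> * Re (L z))"
      using isCont_L by (intro continuous_intros) (simp add: continuous_at_imp_continuous_on)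
    then show ?thesis unfolding E_def by (intro open_Some_image) (simp add: open_Collect_less)
  qed
  moreover have "julia_set F \<subseteq> E 1 \<union> E (-1)"
  proof
    fix x assume "x \<in> julia_set F"
    then have x: "x \<notin> fatou_set F" by (simp add: julia_set_def)
    then obtain z where z: "x = Some z" using None_in_fatou by (cases x) auto
    then have "Re (L z) \<noteq> 0" using x imag_in_fatou by blast
    then show "x \<in> E 1 \<union> E (-1)" using z E by auto
  qed
  moreover have "E 1 \<inter> E (-1) = {}" by (auto simp: E_def)
  moreover have "E 1 \<inter> julia_set F \<noteq> {}"
    using parabolic_in_julia[of 1] E[of "A 1" 1] by (auto simp: julia_set_def)
  moreover have "E (-1) \<inter> julia_set F \<noteq> {}"
    using parabolic_in_julia[of "-1"] E[of "A (-1)" "-1"] by (auto simp: julia_set_def)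
  ultimately show ?thesis unfolding connectedin by blast
qed

end

section \<open>Herman rings\<close>

context stirling_moebius
begin

text \<open>From a nonzero point of the imaginary axis moduli at least double at each step, which
  contradicts a bound even along multiples of \<open>p\<close> only.\<close>

lemma orbit_avoids_imag_if_bounded:
  assumes z: "\<And>n. (F ^^ n) (Some z) \<noteq> None" and p: "p > 0"
    and bound: "\<And>m. cmod ((St ^^ (p * m)) (L z)) \<le> C"
  shows "Re ((St ^^ n) (L z)) \<noteq> 0"
proof
  assume Re: "Re ((St ^^ n) (L z)) = 0"
  define u where "u = (St ^^ n) (L z)"
  have u: "u \<noteq> 0" using funpow_F_finite[OF z[of "Suc n"], of n] by (simp add: u_def)
  obtain k where "C / cmod u < 2 ^ k" using real_arch_pow[of 2 "C / cmod u"] by auto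
  \<comment> \<open>\<open>p * (n + k)\<close> is a multiple of \<open>p\<close> at least
    \<open>k\<close> steps after time \<open>n\<close>.\<close>
  moreover have "(2 :: real) ^ k \<le> 2 ^ (p * (n + k) - n)"
  proof (intro power_increasing)
    have "n + k \<le> p * (n + k)" using p by simp
    then show "k \<le> p * (n + k) - n" by linarith
  qed simp
  ultimately have "C / cmod u < 2 ^ (p * (n + k) - n)" by linarith
  then have "C < 2 ^ (p * (n + k) - n) * cmod u" using u by (simp add: divide_simps)
  also have "\<dots> \<le> cmod ((St ^^ (p * (n + k) - n)) u)"
    using funpow_St_imag(2)[OF u] Re by (simp add: u_def)
  also have "(St ^^ (p * (n + k) - n)) u = (St ^^ (p * (n + k))) (L z)"
  proof -
    have "n \<le> p * (n + k)" using p by (cases p) auto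
    then show ?thesis unfolding u_def by (metis comp_apply funpow_add le_add_diff_inverse2)
  qed
  finally show False using bound[of "n + k"] by simp
qed

lemma continuous_on_funpow_St:
  assumes "\<And>z. z \<in> S \<Longrightarrow> (F ^^ n) (Some z) \<noteq> None"
  shows "continuous_on S (\<lambda>z. (St ^^ n) (L z))"
proof (rule continuous_at_imp_continuous_on, rule ballI)
  fix z assume "z \<in> S"
  then show "isCont (\<lambda>z. (St ^^ n) (L z)) z"
    using assms funpow_F_finite by (intro isCont_funpow_St) blast
qed

text \<open>Orbits return to \<open>K\<close> at multiples of \<open>p\<close>, so all their values
  lie in the compact images of \<open>K\<close> under the first \<open>p\<close> iterates. An orbit
  reaching infinity would stay there and never return.\<close>

lemma invariant_compact_orbits_bounded:
  assumes K: "compact K" and p: "p > 0"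
    and inv: "\<And>z. z \<in> K \<Longrightarrow> (F ^^ p) (Some z) \<in> Some ` K"
  shows "\<exists>C. \<forall>z\<in>K. \<forall>n. (F ^^ n) (Some z) \<noteq> None \<and> Re ((St ^^ n) (L z)) \<noteq> 0 \<and> cmod ((St ^^ n) (L z)) \<le> C"
proof -
  have inv_mult: "(F ^^ (p * m)) (Some z) \<in> Some ` K" if "z \<in> K" for z m
  proof (induction m)
    case (Suc m)
    then obtain y where "y \<in> K" "(F ^^ (p * m)) (Some z) = Some y" by auto
    then show ?case using inv[of y] by (simp add: funpow_add)
  qed (use that in simp)
  have fin: "(F ^^ n) (Some z) \<noteq> None" if "z \<in> K" for z n
  proof
    assume *: "(F ^^ n) (Some z) = None"
    have "n \<le> p * n" using p by simp
    then have "(F ^^ (p * n)) (Some z) = (F ^^ (p * n - n)) ((F ^^ n) (Some z))"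
      by (metis comp_apply funpow_add le_add_diff_inverse2)
    then show False using inv_mult[OF that, of n] * by auto
  qed
  have orbit: "(F ^^ n) (Some z) = Some (A ((St ^^ n) (L z)))" if "z \<in> K" for z n
    using funpow_F_finite[OF fin[OF that, of n]] by (intro funpow_F_Some) blast
  have return: "\<exists>y\<in>K. (St ^^ (p * m)) (L z) = L y" if "z \<in> K" for z m
    using inv_mult[OF that, of m] orbit[OF that, of "p * m"] by (metis L_A imageE option.inject)
  have "bounded (\<Union>j<p. (\<lambda>z. (St ^^ j) (L z)) ` K)"
    using K fin by (intro bounded_UN compact_imp_bounded compact_continuous_image continuous_on_funpow_St ballI) auto
  then obtain C where C: "\<And>j z. j < p \<Longrightarrow> z \<in> K \<Longrightarrow> cmod ((St ^^ j) (L z)) \<le> C"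
    unfolding bounded_iff by blast
  have bound: "cmod ((St ^^ n) (L z)) \<le> C" if z: "z \<in> K" for z n
  proof -
    obtain y where y: "y \<in> K" "(St ^^ (p * (n div p))) (L z) = L y" using return[OF z] by blast
    have "(St ^^ n) (L z) = (St ^^ (n mod p)) ((St ^^ (p * (n div p))) (L z))"
      by (metis comp_apply funpow_add mod_mult_div_eq)
    then show ?thesis using C[of "n mod p" y] y p by simp
  qed
  show ?thesis
    using fin bound orbit_avoids_imag_if_bounded[OF fin p] by (intro exI[of _ C]) blast
qed

text \<open>The bound for iterates on \<open>K\<close> spreads to \<open>D\<close> by the maximum
  modulus principle, once every iterate is known to be holomorphic on \<open>D\<close>; Montel's
  theorem then applies.\<close>

lemma interior_in_fatou:
  assumes D: "open D" "bounded D" "frontier D \<subseteq> K" and K: "compact K" "connected K" "K \<noteq> {}"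
    and p: "p > 0" and inv: "\<And>z. z \<in> K \<Longrightarrow> (F ^^ p) (Some z) \<in> Some ` K"
  shows "Some ` D \<subseteq> fatou_set F"
proof -
  define h where "h n z = (St ^^ n) (L z)" for n z
  obtain C where C: "\<And>z n. z \<in> K \<Longrightarrow> Re (h n z) \<noteq> 0" "\<And>z n. z \<in> K \<Longrightarrow> cmod (h n z) \<le> C"
    using invariant_compact_orbits_bounded[OF K(1) p inv] unfolding h_def by metis
  have cl: "closure D \<subseteq> D \<union> K" using D(3) closure_Un_frontier[of D] by auto
  \<comment> \<open>The three claims are proved together: a nonzero real part keeps
    \<open>h n\<close> off the pole, which makes \<open>h (Suc n)\<close> holomorphic, and the
    values on \<open>K\<close> then give its real part.\<close>
  have h: "h n holomorphic_on D \<and> continuous_on (D \<union> K) (h n) \<and> (\<forall>z\<in>D \<union> K. Re (h n z) \<noteq> 0)" for n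
  proof (induction n)
    case 0
    have "h 0 = L" by (simp add: h_def fun_eq_iff)
    then have "h 0 holomorphic_on D" "continuous_on (D \<union> K) (h 0)"
      using holomorphic_L holomorphic_on_imp_continuous_on by auto
    then show ?case using Re_nonzero_if_frontier[OF D K] C(1) by blast
  next
    case (Suc n)
    have eq: "h (Suc n) = St \<circ> h n" by (simp add: h_def fun_eq_iff)
    have "h n z \<noteq> 0" if "z \<in> D \<union> K" for z
      using Suc that by (metis zero_complex.sel(1))
    then have nz: "h n ` (D \<union> K) \<subseteq> - {0}" by auto
    have "h (Suc n) holomorphic_on D" unfolding eq
      using Suc nz holomorphic_St by (intro holomorphic_on_compose_gen) auto
    moreover have "continuous_on (D \<union> K) (h (Suc n))" unfolding eq
      using Suc continuous_on_subset[OF holomorphic_on_imp_continuous_on[OF holomorphic_St] nz]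
      by (intro continuous_on_compose) auto
    ultimately show ?case using Re_nonzero_if_frontier[OF D K] C(1) by blast
  qed
  have nz: "(St ^^ n) (L z) \<noteq> 0" if "z \<in> D" for n z
    using h[of n] that unfolding h_def by (metis UnI1 zero_complex.sel(1))
  have bound: "cmod (h n z) \<le> C" if "z \<in> D" for n z
  proof (rule maximum_modulus_frontier[OF _ _ D(2) _ that])
    show "h n holomorphic_on interior D" using h D(1) by (simp add: interior_open)
    show "continuous_on (closure D) (h n)" using h cl continuous_on_subset by blast
    show "cmod (h n x) \<le> C" if "x \<in> frontier D" for x using C(2) D(3) that by blast
  qed
  have "normal_iter_on F (Some ` D)"
  proof (rule normal_iter_on_Montel[OF D(1)])
    show "(\<lambda>z. A (h n z)) holomorphic_on D" for n
      using holomorphic_on_compose_gen[of "h n" D A UNIV] h holomorphic_A by (auto simp: o_def)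
    show "(F ^^ n) (Some z) = Some (A (h n z))" if "z \<in> D" for n z
      using nz[OF that] unfolding h_def by (intro funpow_F_Some)
    show "cmod (A (h n z)) \<le> (cmod \<beta> * C + cmod d) / cmod c" if "z \<in> D" for n z
    proof -
      have "cmod (\<beta> * h n z - d) \<le> cmod (\<beta> * h n z) + cmod d" by (rule norm_triangle_ineq4)
      also have "\<dots> \<le> cmod \<beta> * C + cmod d" using bound[OF that] by (simp add: norm_mult mult_left_mono)
      finally show ?thesis by (simp add: A_def norm_divide divide_right_mono)
    qed
  qed
  then show ?thesis using open_Some_image[OF D(1)] unfolding fatou_set_def by blast
qed

lemma no_herman_ring: "\<not> herman_ring F U"
proof
  assume "herman_ring F U"
  then obtain p \<phi> r R \<theta> where U: "U \<in> fatou_components F" and p: "p > 0" and FU: "(F ^^ p) ` U = U"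
    and r: "0 < r" "r < R" and \<theta>: "\<theta> \<notin> \<rat>" and holo: "sph_holomorphic_on \<phi> U"
    and bij: "bij_betw \<phi> U {w. r < cmod w \<and> cmod w < R}"
    and rot: "\<And>z. z \<in> U \<Longrightarrow> \<phi> ((F ^^ p) z) = exp (2 * of_real pi * \<i> * of_real \<theta>) * \<phi> z"
    unfolding herman_ring_def by blast
  have \<phi>_nz: "\<phi> z \<noteq> 0" if "z \<in> U" for z
    using bij_betwE[OF bij] that r by fastforce
  \<comment> \<open>Infinity is fixed, whereas an irrational rotation fixes no nonzero
    value.\<close>
  have "None \<notin> U"
  proof
    assume N: "None \<in> U"
    have "exp (2 * of_real pi * \<i> * of_real \<theta>) = 1" using rot[OF N] \<phi>_nz[OF N] by simp
    then obtain n :: int where "2 * pi * \<theta> = of_int (2 * n) * pi" unfolding exp_eq_1 by auto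
    then have "\<theta> = of_int n" by simp
    then show False using \<theta> by simp
  qed
  define V where "V = Some -` U"
  have UV: "U = Some ` V" using \<open>None \<notin> U\<close> unfolding V_def
    by (auto simp: image_iff) (metis not_Some_eq)
  define \<psi> where "\<psi> = \<phi> \<circ> Some"
  have V: "open V" unfolding V_def by (rule open_fatou_component[OF U])
  have \<psi>: "\<psi> holomorphic_on V" using holo unfolding sph_holomorphic_on_def \<psi>_def V_def by blast
  have inj: "inj_on \<psi> V" unfolding \<psi>_def
    using bij by (intro comp_inj_on) (auto simp: bij_betw_def UV)
  have img: "\<psi> ` V = {w. r < cmod w \<and> cmod w < R}"
    using bij by (simp add: bij_betw_def UV \<psi>_def image_comp)
  obtain h where h: "h holomorphic_on (\<psi> ` V)" "\<And>z. z \<in> V \<Longrightarrow> h (\<psi> z) = z"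
    using holomorphic_has_inverse[OF \<psi> V inj] by metis
  \<comment> \<open>The preimage \<open>K\<close> of the middle circle of the annulus is the core
    curve. It is a Jordan curve because \<open>h\<close> inverts \<open>\<psi>\<close>.\<close>
  define \<rho> where "\<rho> = (r + R) / 2"
  have \<rho>: "r < \<rho>" "\<rho> < R" "0 < \<rho>" using r by (auto simp: \<rho>_def)
  have circ: "sphere 0 \<rho> \<subseteq> \<psi> ` V" using \<rho> unfolding img by auto
  define \<gamma> where "\<gamma> = h \<circ> circlepath 0 \<rho>"
  define K where "K = path_image \<gamma>"
  have K_eq: "K = h ` sphere 0 \<rho>" using \<rho> by (simp add: K_def \<gamma>_def path_image_compose)
  have h_mem: "h w \<in> V" and \<psi>h: "\<psi> (h w) = w" if "w \<in> \<psi> ` V" for w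
    using that h(2) by auto
  have KV: "K \<subseteq> V" using h_mem circ unfolding K_eq by blast
  have K_iff: "z \<in> K \<longleftrightarrow> cmod (\<psi> z) = \<rho>" if "z \<in> V" for z
  proof
    assume "z \<in> K" then show "cmod (\<psi> z) = \<rho>" using \<psi>h circ unfolding K_eq by auto
  next
    assume "cmod (\<psi> z) = \<rho>"
    then have "h (\<psi> z) \<in> K" unfolding K_eq by (intro imageI) simp
    then show "z \<in> K" using h(2)[OF that] by simp
  qed
  have sp: "simple_path \<gamma>" unfolding \<gamma>_def
  proof (rule simple_path_continuous_image)
    show "simple_path (circlepath 0 \<rho>)" using \<rho> by (simp add: simple_path_circlepath)
    show "continuous_on (path_image (circlepath 0 \<rho>)) h"
      using holomorphic_on_imp_continuous_on[OF h(1)] circ \<rho> continuous_on_subset by fastforce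
    show "inj_on h (path_image (circlepath 0 \<rho>))"
      using \<psi>h circ \<rho> by (intro inj_on_inverseI[of _ \<psi>]) auto
  qed
  have "pathfinish \<gamma> = pathstart \<gamma>" by (simp add: \<gamma>_def pathfinish_compose pathstart_compose)
  note jordan = Jordan_inside_outside[OF sp this]
  define D where "D = inside K"
  have D: "D \<noteq> {}" "open D" "connected D" "bounded D" "frontier D = K" "D \<inter> K = {}"
    using jordan inside_no_overlap[of K] unfolding D_def K_def by auto
  have K: "compact K" "connected K" "K \<noteq> {}"
    using simple_path_imp_path[OF sp] unfolding K_def
    by (auto intro: compact_path_image connected_path_image)
  have inv: "(F ^^ p) (Some z) \<in> Some ` K" if "z \<in> K" for z
  proof -
    have zU: "Some z \<in> U" using that KV UV by auto
    then obtain y where y: "(F ^^ p) (Some z) = Some y" "y \<in> V" using FU UV by blast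
    have "cmod (\<psi> y) = cmod (\<psi> z)"
      using rot[OF zU] y(1) by (simp add: \<psi>_def norm_mult)
    then have "y \<in> K" using K_iff y(2) that KV by auto
    then show ?thesis using y(1) by simp
  qed
  \<comment> \<open>The closed region is connected, lies in the Fatou set and meets \<open>U\<close>
    along \<open>K\<close>, so the component \<open>U\<close> contains it.\<close>
  have "Some ` (D \<union> K) \<subseteq> U"
  proof (rule fatou_component_maximal[OF U])
    have "D \<union> K = closure D" using D(5) closure_Un_frontier[of D] by simp
    then show "connectedin sphere_top (Some ` (D \<union> K))"
      using D(3) by (intro connectedin_Some_image) (simp add: connected_imp_connected_closure)
    have "Some ` D \<subseteq> fatou_set F" using interior_in_fatou[OF D(2,4) _ K p inv] D(5) by simp
    moreover have "Some ` K \<subseteq> fatou_set F" using KV UV fatou_component_subset[OF U] by auto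
    ultimately show "Some ` (D \<union> K) \<subseteq> fatou_set F" by auto
    show "Some ` (D \<union> K) \<inter> U \<noteq> {}" using K(3) KV UV by auto
  qed
  then have DV: "D \<union> K \<subseteq> V" using UV by auto
  obtain z where z: "z \<in> D" using D(1) by auto
  have \<psi>_nz: "\<psi> x \<noteq> 0" if "x \<in> V" for x using \<phi>_nz[of "Some x"] that UV by (simp add: \<psi>_def)
  have cl: "closure D \<subseteq> V" using DV D(5) closure_Un_frontier[of D] by simp
  have \<psi>K: "cmod (\<psi> x) = \<rho>" if "x \<in> frontier D" for x using that K_iff KV D(5) by auto
  \<comment> \<open>The maximum principle for \<open>\<psi>\<close> and for
    \<open>1 / \<psi>\<close> gives \<open>|\<psi> z| = \<rho>\<close>. Injectivity, through
    \<open>K_iff\<close>, then puts the interior point \<open>z\<close> on \<open>K\<close>.\<close>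
  have "cmod (\<psi> z) \<le> \<rho>"
  proof (rule maximum_modulus_frontier[OF _ _ D(4) _ z])
    show "\<psi> holomorphic_on interior D" using \<psi> DV D(2) by (auto simp: interior_open elim: holomorphic_on_subset)
    show "continuous_on (closure D) \<psi>" using \<psi> cl holomorphic_on_imp_continuous_on holomorphic_on_subset by blast
  qed (use \<psi>K in auto)
  moreover have "cmod (1 / \<psi> z) \<le> 1 / \<rho>"
  proof (rule maximum_modulus_frontier[OF _ _ D(4) _ z])
    have inv: "(\<lambda>x. 1 / \<psi> x) holomorphic_on V" using \<psi> \<psi>_nz by (intro holomorphic_intros)
    show "(\<lambda>x. 1 / \<psi> x) holomorphic_on interior D"
      using inv DV D(2) by (auto simp: interior_open elim: holomorphic_on_subset)
    show "continuous_on (closure D) (\<lambda>x. 1 / \<psi> x)"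
      using inv cl holomorphic_on_imp_continuous_on holomorphic_on_subset by blast
  qed (use \<psi>K in \<open>auto simp: norm_divide\<close>)
  then have "\<rho> \<le> cmod (\<psi> z)" using \<psi>_nz[of z] z DV \<rho> by (simp add: norm_divide field_simps subset_iff)
  ultimately have "z \<in> K" using K_iff z DV by auto
  then show False using z D(6) by auto
qed

end

theorem theorem4p1:
  fixes b c d :: complex and F :: "csphere \<Rightarrow> csphere"
  assumes "b \<noteq> 0" and "c \<noteq> 0"
    and St: "rational_map_of F (stirling_fun (\<lambda>z. b / (c * z + d)))"
  shows "(\<forall>z. c * z + d \<noteq> 0 \<longrightarrow>
            F (Some z) = Some (z + ((c * z + d)\<^sup>2 - b * c)\<^sup>2 / (c * (c * z + d) ^ 3)))
       \<and> (\<exists>p q. q \<noteq> 0 \<and> coprime p q \<and> F = rat_map p q \<and> max (degree p) (degree q) = 4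
              \<and> finite (critical_points p q)
              \<and> (\<Sum>z\<in>critical_points p q. local_deg p q z - 1) = 6)
       \<and> attracting_fixed_inf F (1/2)
       \<and> at_most_one_herman_cycle F
       \<and> \<not> connectedin sphere_top (julia_set F)"
proof -
  interpret stirling_moebius b c d using assms(1,2) by unfold_locales
  have F: "F = rat_map num den" using rational_map_of_stirling[OF St] .
  show ?thesis
  proof (intro conjI)
    show "\<forall>z. c * z + d \<noteq> 0 \<longrightarrow>
        F (Some z) = Some (z + ((c * z + d)\<^sup>2 - b * c)\<^sup>2 / (c * (c * z + d) ^ 3))"
      unfolding F using c quotient_eq by (auto simp: rat_map_def poly_den)
    show "\<exists>p q. q \<noteq> 0 \<and> coprime p q \<and> F = rat_map p q \<and> max (degree p) (degree q) = 4
        \<and> finite (critical_points p q) \<and> (\<Sum>z\<in>critical_points p q. local_deg p q z - 1) = 6"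
      using den_nz coprime_num_den F degree_num degree_den finite_critical_points sum_critical_points
      by (intro exI[of _ num] exI[of _ den]) simp
    \<comment> \<open>Holds vacuously, since there are no Herman rings.\<close>
    show "at_most_one_herman_cycle F"
      unfolding F at_most_one_herman_cycle_def using no_herman_ring by blast
  qed (simp_all only: F attracting julia_disconnected not_False_eq_True)
qed

end
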